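(* Let $B^K_t=\int_0^t K(t,s)\,\mathrm{d}W_s$, $t\in[0,T]$, be a Volterra process whose $L^2$ kernel $K$ satisfies, for some $H\in(0,1)$ and $c\in(0,\infty)$, $\big(\int_{t-\varepsilon}^t K(t,s)^2\,\mathrm{d}s\big)^{1/2}\ge c\,\varepsilon^H$ for all $t\in(0,T]$ and $\varepsilon\in(0,t)$. Let $x_0\in\mathbb{R}$ and consider the SDE $$\mathrm{d}X_t=b(t,X_t)\,\mathrm{d}t+\mathrm{d}B^K_t,\quad t\in[0,T],\qquad X_0=x_0.$$ Let $M\subset\mathbb{R}$ be a set such that $\mathbb{R}\setminus M$ is countable. (1) If $b(t,x)=b(x)=\mathbf{1}_M(x)$, $x\in\mathbb{R}$, then the SDE admits a unique strong solution. (2) More generally, if $b(t,x)=\tilde b(t,x)\,\mathbf{1}_M(x)$, where $\tilde b\colon[0,T]\times\mathbb{R}\to\mathbb{R}$ is a measurable, uniformly bounded function such that the SDE with $b$ replaced by $\tilde b$ admits a unique strong solution, then the SDE with $b$ also admits a unique strong solution.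
   Context: $T\in(0,\infty)$ is fixed, $(\Omega,(\mathcal{A}_t)_{t\in[0,T]},\mathbb{P})$ is a filtered probability space, $(W_t)_{t\in[0,T]}$ is a standard one-dimensional Brownian motion on it, and $(\mathcal{A}_t)$ is the augmented filtration generated by $W$, satisfying the usual conditions. An $L^2$ kernel is a function $K\colon[0,T]\times[0,T]\to\mathbb{R}$ with $\int_0^T\int_0^T K(t,s)^2\,\mathrm{d}t\,\mathrm{d}s<\infty$ (the Wiener integrals defining $B^K_t$ are assumed well defined for each $t$). A strong solution is an $(\mathcal{A}_t)$-adapted process $X$ on the given space with $X_t=x_0+\int_0^t b(s,X_s)\,\mathrm{d}s+B^K_t$, $t\in[0,T]$, almost surely; uniqueness means that any two ($(\mathcal{A}_t)$-adapted) solutions coincide for every $t\in[0,T]$ almost surely. *)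

theory Defs
  imports "HOL-Probability.Probability"
begin

text \<open>
  Throughout, \<open>P\<close> is the underlying probability measure, processes are curried functions
  \<open>time \<Rightarrow> outcome \<Rightarrow> real\<close>, and only their values at times in \<open>{0..T}\<close> matter.
\<close>

text \<open>
  The filtration generated by \<open>W\<close>, augmented by all null sets of \<open>P\<close>. It is used together with
  the assumption that \<open>P\<close> is complete. For a Brownian motion the result is automatically
  right-continuous, so the usual conditions need not be imposed separately.
\<close>

definition augmented_filtration :: "'w measure \<Rightarrow> (real \<Rightarrow> 'w \<Rightarrow> real) \<Rightarrow> real \<Rightarrow> 'w measure" where
  "augmented_filtration P W t =
     sigma (space P)
       ({W s -` S \<inter> space P | s S. s \<in> {0..t} \<and> S \<in> sets borel} \<union> null_sets P)"

definition adapted :: "(real \<Rightarrow> 'w measure) \<Rightarrow> real \<Rightarrow> (real \<Rightarrow> 'w \<Rightarrow> real) \<Rightarrow> bool" where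
  "adapted A T X \<longleftrightarrow> (\<forall>t\<in>{0..T}. X t \<in> borel_measurable (A t))"

definition brownian_motion ::
    "'w measure \<Rightarrow> (real \<Rightarrow> 'w measure) \<Rightarrow> real \<Rightarrow> (real \<Rightarrow> 'w \<Rightarrow> real) \<Rightarrow> bool" where
  "brownian_motion P A T W \<longleftrightarrow>
     prob_space P \<and>
     (\<forall>t\<in>{0..T}. W t \<in> borel_measurable P) \<and>
     adapted A T W \<and>
     (AE \<omega> in P. W 0 \<omega> = 0) \<and>
     (AE \<omega> in P. continuous_on {0..T} (\<lambda>t. W t \<omega>)) \<and>
     (\<forall>s t. 0 \<le> s \<and> s < t \<and> t \<le> T \<longrightarrow>
        distributed P lborel (\<lambda>\<omega>. W t \<omega> - W s \<omega>) (normal_density 0 (sqrt (t - s))) \<and>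
        prob_space.indep_set P (sets (A s))
          (sets (vimage_algebra (space P) (\<lambda>\<omega>. W t \<omega> - W s \<omega>) borel)))"

text \<open>
  A list of triples \<open>(c, a, b)\<close> encodes the step function that is the sum of the
  \<open>c * indicator {a<..b}\<close>.
\<close>

definition step_fun :: "(real \<times> real \<times> real) list \<Rightarrow> real \<Rightarrow> real" where
  "step_fun p s = (\<Sum>(c, a, b)\<leftarrow>p. c * indicator {a<..b} s)"

definition step_wiener_integral ::
    "(real \<Rightarrow> 'w \<Rightarrow> real) \<Rightarrow> (real \<times> real \<times> real) list \<Rightarrow> 'w \<Rightarrow> real" where
  "step_wiener_integral W p \<omega> = (\<Sum>(c, a, b)\<leftarrow>p. c * (W b \<omega> - W a \<omega>))"

text \<open>
  \<open>Y\<close> is a version of the Wiener integral of \<open>f\<close> over \<open>{0..t}\<close>: the limit in \<open>L\<^sup>2(P)\<close> of the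
  integrals of step functions that converge to \<open>f\<close> in \<open>L\<^sup>2({0..t})\<close>. By the Wiener isometry, \<open>Y\<close> is
  determined up to a null set and does not depend on the approximating sequence.
\<close>

definition has_wiener_integral ::
    "'w measure \<Rightarrow> (real \<Rightarrow> 'w \<Rightarrow> real) \<Rightarrow> real \<Rightarrow> (real \<Rightarrow> real) \<Rightarrow> ('w \<Rightarrow> real) \<Rightarrow> bool" where
  "has_wiener_integral P W t f Y \<longleftrightarrow>
     Y \<in> borel_measurable P \<and>
     (\<exists>p. (\<forall>n. \<forall>(c, a, b)\<in>set (p n). 0 \<le> a \<and> a \<le> b \<and> b \<le> t) \<and>
        (\<lambda>n. \<integral>\<^sup>+s\<in>{0..t}. ennreal ((f s - step_fun (p n) s)\<^sup>2) \<partial>lborel) \<longlonglongrightarrow> 0 \<and>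
        (\<lambda>n. \<integral>\<^sup>+\<omega>. ennreal ((Y \<omega> - step_wiener_integral W (p n) \<omega>)\<^sup>2) \<partial>P) \<longlonglongrightarrow> 0)"

text \<open>
  The last conjunct is not implied by the others, which control \<open>K t\<close> only for almost every \<open>t\<close>;
  it makes the Wiener integral of \<open>K t\<close> over \<open>{0..t}\<close> exist for each \<open>t\<close>.
\<close>

definition L2_kernel :: "real \<Rightarrow> (real \<Rightarrow> real \<Rightarrow> real) \<Rightarrow> bool" where
  "L2_kernel T K \<longleftrightarrow>
     (\<lambda>(t, s). K t s) \<in> borel_measurable (restrict_space borel {0..T} \<Otimes>\<^sub>M restrict_space borel {0..T}) \<and>
     set_integrable (lborel \<Otimes>\<^sub>M lborel) ({0..T} \<times> {0..T}) (\<lambda>(t, s). (K t s)\<^sup>2) \<and>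
     (\<forall>t\<in>{0..T}. set_integrable lborel {0..t} (\<lambda>s. (K t s)\<^sup>2))"

text \<open>
  \<open>B\<close> is a version of the process \<open>B\<^sub>t = \<integral>\<^sub>0\<^sup>t K(t,s) dW\<^sub>s\<close>. For each single \<open>t\<close> the Wiener integral
  is determined only up to a null set, so the paths of \<open>B\<close> depend on the version. As usual
  for a process that enters pathwise Lebesgue integrals over time, the version is taken
  to be jointly measurable in time and outcome.
\<close>

definition volterra_process ::
    "'w measure \<Rightarrow> real \<Rightarrow> (real \<Rightarrow> 'w \<Rightarrow> real) \<Rightarrow> (real \<Rightarrow> real \<Rightarrow> real) \<Rightarrow> (real \<Rightarrow> 'w \<Rightarrow> real) \<Rightarrow> bool" where
  "volterra_process P T W K B \<longleftrightarrow>
     (\<lambda>(t, \<omega>). B t \<omega>) \<in> borel_measurable (restrict_space borel {0..T} \<Otimes>\<^sub>M P) \<and>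
     (\<forall>t\<in>{0..T}. has_wiener_integral P W t (K t) (B t))"

definition strong_solution ::
    "'w measure \<Rightarrow> (real \<Rightarrow> 'w measure) \<Rightarrow> real \<Rightarrow> (real \<Rightarrow> 'w \<Rightarrow> real) \<Rightarrow>
     (real \<Rightarrow> real \<Rightarrow> real) \<Rightarrow> real \<Rightarrow> (real \<Rightarrow> 'w \<Rightarrow> real) \<Rightarrow> bool" where
  "strong_solution P A T B b x0 X \<longleftrightarrow>
     adapted A T X \<and>
     (AE \<omega> in P. \<forall>t\<in>{0..T}.
        set_integrable lborel {0..t} (\<lambda>s. b s (X s \<omega>)) \<and>
        X t \<omega> = x0 + (LINT s:{0..t}|lborel. b s (X s \<omega>)) + B t \<omega>)"

definition unique_strong_solution ::
    "'w measure \<Rightarrow> (real \<Rightarrow> 'w measure) \<Rightarrow> real \<Rightarrow> (real \<Rightarrow> 'w \<Rightarrow> real) \<Rightarrow>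
     (real \<Rightarrow> real \<Rightarrow> real) \<Rightarrow> real \<Rightarrow> bool" where
  "unique_strong_solution P A T B b x0 \<longleftrightarrow>
     (\<exists>X. strong_solution P A T B b x0 X) \<and>
     (\<forall>X Y. strong_solution P A T B b x0 X \<longrightarrow> strong_solution P A T B b x0 Y \<longrightarrow>
        (AE \<omega> in P. \<forall>t\<in>{0..T}. X t \<omega> = Y t \<omega>))"

end

theory Submission
  imports Defs
begin

text \<open>
  A solution with bounded drift spends almost surely Lebesgue-null time in each point \<open>x\<close>, hence
  in the countable complement of \<open>M\<close>, so the drifts \<open>b\<close> and \<open>b \<cdot> 1\<^sub>M\<close> have the same solutions.

  By Fubini it is enough that \<open>X\<^sub>t \<noteq> x\<close> almost surely for every \<open>t > 0\<close>. Freeze the solution at time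
  \<open>s = t - \<epsilon>\<close>: up to the drift over \<open>[s, t]\<close>, which is at most \<open>C\<epsilon>\<close>, \<open>X\<^sub>t\<close> is an \<open>\<A>\<^sub>s\<close>-measurable variable
  plus an independent Gaussian one of standard deviation at least \<open>c\<epsilon>\<^sup>H\<close>, so \<open>P(X\<^sub>t = x)\<close> is of
  order \<open>\<epsilon> / \<epsilon>\<^sup>H\<close>, which vanishes as \<open>\<epsilon> \<rightarrow> 0\<close> because \<open>H < 1\<close>. Gaussian small-ball bounds are read off from
  \<open>E n\<^sub>\<sigma>(V + G)\<close> with \<open>n\<^sub>\<sigma>\<close> the centred normal density: adding one independent increment of \<open>W\<close> at
  a time only enlarges the variance of \<open>n\<^sub>\<sigma>\<close>, whence no joint law of increments is needed.
\<close>

subsection \<open>Step functions and path regularity\<close>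

lemma lift_Suc_less_imp_le:
  fixes \<tau> :: "nat \<Rightarrow> 'a :: preorder"
  assumes "\<And>i. i < m \<Longrightarrow> \<tau> i < \<tau> (Suc i)" and "i \<le> j" "j \<le> m"
  shows "\<tau> i \<le> \<tau> j"
  using assms(2,3)
proof (induction j rule: dec_induct)
  case (step n)
  then have "\<tau> i \<le> \<tau> n" "\<tau> n < \<tau> (Suc n)"
    using assms(1)[of n] by simp_all
  then show ?case by (blast intro: order_trans less_imp_le)
qed simp

text \<open>Applied to the square of a step function on its grid, this identifies the variance
  collected from the increments with an integral over \<open>(s, t]\<close>, which can then be
  compared with the kernel.\<close>

lemma nn_integral_piecewise_const:
  fixes \<tau> :: "nat \<Rightarrow> real" and f :: "real \<Rightarrow> real"
  assumes meas: "f \<in> borel_measurable borel"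
    and mono: "\<And>i. i < m \<Longrightarrow> \<tau> i < \<tau> (Suc i)"
    and const: "\<And>i r. i < m \<Longrightarrow> r \<in> {\<tau> i<..\<tau> (Suc i)} \<Longrightarrow> f r = v i"
    and nonneg: "\<And>i. i < m \<Longrightarrow> 0 \<le> v i"
  shows "(\<integral>\<^sup>+r\<in>{\<tau> 0<..\<tau> m}. ennreal (f r) \<partial>lborel) = ennreal (\<Sum>i<m. v i * (\<tau> (Suc i) - \<tau> i))"
  using mono const nonneg
proof (induction m)
  case 0
  then show ?case by simp
next
  case (Suc m)
  then have IH: "(\<integral>\<^sup>+r\<in>{\<tau> 0<..\<tau> m}. ennreal (f r) \<partial>lborel) = ennreal (\<Sum>i<m. v i * (\<tau> (Suc i) - \<tau> i))"
    by simp
  have le: "\<tau> 0 \<le> \<tau> m"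
    using Suc.prems(1) by (rule lift_Suc_less_imp_le[of "Suc m"]) auto
  have lt: "\<tau> m < \<tau> (Suc m)" using Suc.prems(1) by simp
  have eq: "{\<tau> 0<..\<tau> (Suc m)} = {\<tau> 0<..\<tau> m} \<union> {\<tau> m<..\<tau> (Suc m)}"
    using le lt by auto
  have "(\<integral>\<^sup>+r\<in>{\<tau> m<..\<tau> (Suc m)}. ennreal (f r) \<partial>lborel)
      = (\<integral>\<^sup>+r\<in>{\<tau> m<..\<tau> (Suc m)}. ennreal (v m) \<partial>lborel)"
    using Suc.prems(2)[of m] by (intro nn_integral_cong) (auto split: split_indicator)
  also have "\<dots> = ennreal (v m * (\<tau> (Suc m) - \<tau> m))"
    using lt Suc.prems(3)[of m] by (simp add: nn_integral_cmult_indicator ennreal_mult)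
  finally have last: "(\<integral>\<^sup>+r\<in>{\<tau> m<..\<tau> (Suc m)}. ennreal (f r) \<partial>lborel)
      = ennreal (v m * (\<tau> (Suc m) - \<tau> m))" .
  have "(\<integral>\<^sup>+r\<in>{\<tau> 0<..\<tau> (Suc m)}. ennreal (f r) \<partial>lborel) =
     (\<integral>\<^sup>+r\<in>{\<tau> 0<..\<tau> m}. ennreal (f r) \<partial>lborel) + (\<integral>\<^sup>+r\<in>{\<tau> m<..\<tau> (Suc m)}. ennreal (f r) \<partial>lborel)"
    unfolding eq using meas by (intro nn_integral_disjoint_pair) auto
  also have "\<dots> = ennreal ((\<Sum>i<m. v i * (\<tau> (Suc i) - \<tau> i)) + v m * (\<tau> (Suc m) - \<tau> m))"
    unfolding IH last using Suc.prems(1,3)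
    by (intro ennreal_plus[symmetric] sum_nonneg mult_nonneg_nonneg) (auto simp: less_imp_le)
  finally show ?case by simp
qed

text \<open>The intervals listed in \<open>p\<close> may overlap, so their increments of a path need
  not be independent. Sorting all endpoints, clipped below at \<open>s\<close>, gives one partition
  of \<open>(s, t]\<close>: between neighbouring points the step function is constant, and each
  increment telescopes into increments over disjoint cells. The path \<open>w\<close> is arbitrary
  so that one grid serves all outcomes.\<close>

lemma step_fun_grid:
  fixes s t :: real
  assumes p: "\<forall>(c, a, b)\<in>set p. 0 \<le> a \<and> a \<le> b \<and> b \<le> t" and st: "s < t"
  obtains \<tau> :: "nat \<Rightarrow> real" and m where "\<tau> 0 = s" "\<tau> m = t" "\<And>i. i < m \<Longrightarrow> \<tau> i < \<tau> (Suc i)"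
    "\<And>i r. i < m \<Longrightarrow> r \<in> {\<tau> i<..\<tau> (Suc i)} \<Longrightarrow> step_fun p r = step_fun p (\<tau> (Suc i))"
    "\<And>w :: real \<Rightarrow> real. (\<Sum>(c, a, b)\<leftarrow>p. c * (w (max s b) - w (max s a)))
       = (\<Sum>i<m. step_fun p (\<tau> (Suc i)) * (w (\<tau> (Suc i)) - w (\<tau> i)))"
proof -
  \<comment> \<open>Adding \<open>s\<close> and \<open>t\<close> pins the first and the last grid
    point, since all clipped endpoints lie in \<open>[s, t]\<close>.\<close>
  define F where "F = {s, t} \<union> (\<lambda>(c, a, b). max s a) ` set p \<union> (\<lambda>(c, a, b). max s b) ` set p"
  define L where "L = sorted_list_of_set F"
  define m where "m = length L - 1"
  define \<tau> where "\<tau> i = L ! i" for i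
  have fin: "finite F" by (simp add: F_def)
  have setL: "set L = F" and sorted: "sorted_wrt (<) L"
    using fin by (simp_all add: L_def)
  have F_sub: "F \<subseteq> {s..t}" using p st by (fastforce simp: F_def)
  have len: "length L = Suc m"
    using setL by (cases L) (auto simp: m_def F_def)
  have \<tau>_less: "\<tau> i < \<tau> j" if "i < j" "j \<le> m" for i j
    using sorted that len by (auto simp: \<tau>_def sorted_wrt_iff_nth_less)
  have \<tau>_le: "\<tau> i \<le> \<tau> j" if "i \<le> j" "j \<le> m" for i j
    using \<tau>_less[of i j] that by (cases "i = j") auto
  have \<tau>_F: "\<tau> i \<in> F" if "i \<le> m" for i
    using that len setL by (auto simp: \<tau>_def)
  have F_\<tau>: "\<exists>i\<le>m. x = \<tau> i" if "x \<in> F" for x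
    using that len setL by (auto simp: \<tau>_def in_set_conv_nth less_Suc_eq_le)
  have \<tau>0: "\<tau> 0 = s"
    using F_\<tau>[of s] \<tau>_le[of 0] \<tau>_F[of 0] F_sub by (fastforce simp: F_def)
  have \<tau>m: "\<tau> m = t"
    using F_\<tau>[of t] \<tau>_le[of _ m] \<tau>_F[of m] F_sub by (fastforce simp: F_def)
  have \<tau>_iff: "\<tau> i < \<tau> j \<longleftrightarrow> i < j" if "i \<le> m" "j \<le> m" for i j
    using \<tau>_less[of i j] \<tau>_le[of j i] that by (auto simp: not_less[symmetric])
  \<comment> \<open>After time \<open>s\<close> clipping does not change the indicator, so only grid
    points occur as endpoints.\<close>
  have ind_eq: "indicator {a<..b} r = (indicator {max s a<..max s b} r :: real)" if "s < r" for a b r :: real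
    using that by (auto split: split_indicator)
  show ?thesis
  proof (rule that[OF \<tau>0 \<tau>m])
    show "\<tau> i < \<tau> (Suc i)" if "i < m" for i using \<tau>_less that by simp
  next
    fix i r assume i: "i < m" and r: "r \<in> {\<tau> i<..\<tau> (Suc i)}"
    have s: "s < r" "s < \<tau> (Suc i)"
      using r \<tau>_le[of 0 i] i \<tau>0 by auto
    have "indicator {a<..b} r = (indicator {a<..b} (\<tau> (Suc i)) :: real)" if "(c, a, b) \<in> set p" for c a b
    proof -
      have "max s a \<in> F" "max s b \<in> F" using that by (force simp: F_def)+
      then obtain j k where jk: "j \<le> m" "max s a = \<tau> j" "k \<le> m" "max s b = \<tau> k"
        using F_\<tau> by metis
      \<comment> \<open>No grid point lies inside a cell, so \<open>r\<close> and the right end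
        \<open>\<tau> (Suc i)\<close> of its cell compare in the same way with every
        endpoint.\<close>
      have "\<tau> j < r \<longleftrightarrow> j \<le> i" if "j \<le> m" for j
        using r \<tau>_le[of j i] \<tau>_le[of "Suc i" j] i that by (cases "j \<le> i") auto
      moreover have "\<tau> j < \<tau> (Suc i) \<longleftrightarrow> j \<le> i" if "j \<le> m" for j
        using \<tau>_iff[of j "Suc i"] i that by auto
      moreover have "r \<le> \<tau> k \<longleftrightarrow> Suc i \<le> k" if "k \<le> m" for k
        using r \<tau>_le[of k i] \<tau>_le[of "Suc i" k] i that by (cases "k \<le> i") auto
      moreover have "\<tau> (Suc i) \<le> \<tau> k \<longleftrightarrow> Suc i \<le> k" if "k \<le> m" for k
        using \<tau>_iff[of k "Suc i"] i that by (auto simp: not_less[symmetric])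
      ultimately show ?thesis
        unfolding ind_eq[OF s(1), of a b] ind_eq[OF s(2), of a b] jk(2,4) using jk(1,3) by (simp add: indicator_def)
    qed
    then show "step_fun p r = step_fun p (\<tau> (Suc i))"
      unfolding step_fun_def by (intro arg_cong[where f = sum_list] map_cong) auto
  next
    fix w :: "real \<Rightarrow> real"
    have tele: "w (max s b) - w (max s a) =
        (\<Sum>i<m. indicator {a<..b} (\<tau> (Suc i)) * (w (\<tau> (Suc i)) - w (\<tau> i)))"
      if mem: "(c, a, b) \<in> set p" for c a b
    proof -
      have "max s a \<in> F" "max s b \<in> F" using mem by (force simp: F_def)+
      then obtain j k where jk: "j \<le> m" "max s a = \<tau> j" "k \<le> m" "max s b = \<tau> k"
        using F_\<tau> by metis
      have "a \<le> b" using p mem by auto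
      then have "j \<le> k" using \<tau>_iff[of k j] jk by (auto simp: not_less[symmetric])
      \<comment> \<open>The interval from \<open>\<tau> j\<close> to \<open>\<tau> k\<close>
        consists of exactly the cells with index from \<open>j\<close> to \<open>k - 1\<close>, so
        the sum over cells telescopes.\<close>
      have ind: "indicator {a<..b} (\<tau> (Suc i)) = (indicator {j..<k} i :: real)" if "i < m" for i
      proof -
        have "s < \<tau> (Suc i)" using \<tau>_less[of 0 "Suc i"] that \<tau>0 by auto
        then show ?thesis
          unfolding ind_eq[OF \<open>s < \<tau> (Suc i)\<close>, of a b] jk(2,4)
          using \<tau>_iff[of j "Suc i"] \<tau>_iff[of k "Suc i"] that jk(1,3)
          by (auto simp: indicator_def not_less[symmetric])
      qed
      have "(\<Sum>i<m. indicator {a<..b} (\<tau> (Suc i)) * (w (\<tau> (Suc i)) - w (\<tau> i)))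
          = (\<Sum>i<m. indicator {j..<k} i * (w (\<tau> (Suc i)) - w (\<tau> i)))"
        using ind by (intro sum.cong) auto
      also have "\<dots> = (\<Sum>i\<in>{j..<k}. w (\<tau> (Suc i)) - w (\<tau> i))"
        using jk(3) by (intro sum.mono_neutral_cong_right) (auto simp: indicator_def)
      also have "\<dots> = w (\<tau> k) - w (\<tau> j)"
        using \<open>j \<le> k\<close> by (rule sum_Suc_diff')
      finally show ?thesis by (simp add: jk)
    qed
    have tele': "c * (w (max s b) - w (max s a)) =
        (\<Sum>i<m. c * indicator {a<..b} (\<tau> (Suc i)) * (w (\<tau> (Suc i)) - w (\<tau> i)))"
      if mem: "(c, a, b) \<in> set p" for c a b
      unfolding tele[OF mem] sum_distrib_left mult.assoc ..
    have "(\<Sum>(c, a, b)\<leftarrow>p. c * (w (max s b) - w (max s a))) =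
      (\<Sum>(c, a, b)\<leftarrow>p. \<Sum>i<m. c * indicator {a<..b} (\<tau> (Suc i)) * (w (\<tau> (Suc i)) - w (\<tau> i)))"
      using tele' by (intro arg_cong[where f = sum_list] map_cong) auto
    also have "\<dots> = (\<Sum>i<m. \<Sum>(c, a, b)\<leftarrow>p. c * indicator {a<..b} (\<tau> (Suc i)) * (w (\<tau> (Suc i)) - w (\<tau> i)))"
      by (induction p) (auto simp: sum.distrib)
    also have "\<dots> = (\<Sum>i<m. step_fun p (\<tau> (Suc i)) * (w (\<tau> (Suc i)) - w (\<tau> i)))"
      unfolding step_fun_def by (simp add: sum_list_mult_const[symmetric] case_prod_unfold)
    finally show "(\<Sum>(c, a, b)\<leftarrow>p. c * (w (max s b) - w (max s a))) =
      (\<Sum>i<m. step_fun p (\<tau> (Suc i)) * (w (\<tau> (Suc i)) - w (\<tau> i)))" .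
  qed
qed

lemma step_fun_measurable [measurable]: "step_fun p \<in> borel_measurable borel"
  unfolding step_fun_def[abs_def] by (induction p) (auto simp: case_prod_unfold)

section \<open>Lipschitz paths and joint measurability\<close>

lemma set_lborel_integral_increment_bound:
  fixes g :: "real \<Rightarrow> real"
  assumes int: "set_integrable lborel {0..t} g" and st: "0 \<le> s" "s \<le> t"
    and bound: "\<And>r. r \<in> {0..t} \<Longrightarrow> \<bar>g r\<bar> \<le> C"
  shows "\<bar>(LINT r:{0..t}|lborel. g r) - (LINT r:{0..s}|lborel. g r)\<bar> \<le> C * (t - s)"
proof -
  have eq: "{0..t} = {0..s} \<union> {s<..t}" using st by auto
  have ints: "set_integrable lborel {0..s} g" "set_integrable lborel {s<..t} g"
    using st by (auto intro!: set_integrable_subset[OF int])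
  have "(LINT r:{0..t}|lborel. g r) = (LINT r:{0..s}|lborel. g r) + (LINT r:{s<..t}|lborel. g r)"
    unfolding eq using ints by (intro set_integral_Un) auto
  moreover have "\<bar>LINT r:{s<..t}|lborel. g r\<bar> \<le> (\<integral>r. C * indicator {s<..t} r \<partial>lborel)"
    unfolding set_lebesgue_integral_def
  proof (rule order_trans[OF integral_abs_bound], rule integral_mono)
    show "integrable lborel (\<lambda>r. \<bar>indicator {s<..t} r *\<^sub>R g r\<bar>)"
      using ints(2) unfolding set_integrable_def by (rule integrable_abs)
    show "integrable lborel (\<lambda>r. C * indicator {s<..t} r :: real)"
      using st by (intro integrable_mult_right) auto
    show "\<bar>indicator {s<..t} r *\<^sub>R g r\<bar> \<le> C * indicator {s<..t} r" for r
      using bound[of r] st by (auto split: split_indicator)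
  qed
  moreover have "(\<integral>r. C * indicator {s<..t} r \<partial>lborel) = C * (t - s)"
    using st by simp
  ultimately show ?thesis by linarith
qed

text \<open>Adaptedness gives measurability at each fixed time only, whereas Fubini needs it
  jointly. A Lipschitz path is the limit of its values at times rounded to a countable grid; on the
  null set without the Lipschitz bound the modification is set to zero.\<close>

lemma jointly_measurable_modification:
  fixes D :: "real \<Rightarrow> 'w \<Rightarrow> real"
  assumes meas: "\<And>t. t \<in> {0..T} \<Longrightarrow> D t \<in> borel_measurable P"
    and lip: "AE \<omega> in P. \<forall>s\<in>{0..T}. \<forall>t\<in>{0..T}. \<bar>D t \<omega> - D s \<omega>\<bar> \<le> C * \<bar>t - s\<bar>"
  obtains D' where "(\<lambda>(t, \<omega>). D' t \<omega>) \<in> borel_measurable (restrict_space borel {0..T} \<Otimes>\<^sub>M P)"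
    and "AE \<omega> in P. \<forall>t\<in>{0..T}. D' t \<omega> = D t \<omega>"
proof -
  obtain N where N: "N \<in> null_sets P"
    "\<And>\<omega> s t. \<omega> \<in> space P - N \<Longrightarrow> s \<in> {0..T} \<Longrightarrow> t \<in> {0..T} \<Longrightarrow> \<bar>D t \<omega> - D s \<omega>\<bar> \<le> C * \<bar>t - s\<bar>"
    using lip by (elim AE_E3) blast
  define D' where "D' t \<omega> = (if t \<in> {0..T} \<and> \<omega> \<notin> N then D t \<omega> else 0)" for t \<omega>
  have [measurable]: "N \<in> sets P" using N(1) by auto
  have D'_meas [measurable]: "D' t \<in> borel_measurable P" for t
  proof (cases "t \<in> {0..T}")
    case True
    note meas[OF True, measurable]
    have "D' t = (\<lambda>\<omega>. if \<omega> \<notin> N then D t \<omega> else 0)" using True by (auto simp: D'_def)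
    then show ?thesis by simp
  next
    case False
    then have "D' t = (\<lambda>_. 0)" by (auto simp: D'_def)
    then show ?thesis by simp
  qed
  \<comment> \<open>Rounding down to mesh \<open>1 / (n + 1)\<close> leaves countably many times,
    and for \<open>t\<close> in \<open>[0, T]\<close> the rounded time stays in
    \<open>[0, T]\<close>.\<close>
  define \<tau> where "\<tau> n t = real_of_int \<lfloor>real (Suc n) * t\<rfloor> / real (Suc n)" for n t
  have "(\<lambda>(t, \<omega>). D' t \<omega>) \<in> borel_measurable (restrict_space borel {0..T} \<Otimes>\<^sub>M P)"
  proof (rule borel_measurable_LIMSEQ_real)
    show "(\<lambda>z. D' (\<tau> n (fst z)) (snd z)) \<in> borel_measurable (restrict_space borel {0..T} \<Otimes>\<^sub>M P)" for n
    proof -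
      have fl: "(\<lambda>z :: real \<times> 'w. \<lfloor>real (Suc n) * fst z\<rfloor>) \<in> measurable (restrict_space borel {0..T} \<Otimes>\<^sub>M P) (count_space UNIV)"
        by (intro measurable_compose[OF measurable_fst] measurable_restrict_space1) measurable
      show ?thesis
        unfolding \<tau>_def
        by (rule measurable_compose_countable[OF _ fl, of "\<lambda>i z. D' (real_of_int i / real (Suc n)) (snd z)"])
           measurable
    qed
    fix z assume z: "z \<in> space (restrict_space borel {0..T} \<Otimes>\<^sub>M P)"
    then obtain t \<omega> where t: "z = (t, \<omega>)" "t \<in> {0..T}" "\<omega> \<in> space P"
      by (auto simp: space_pair_measure)
    have \<tau>: "0 \<le> \<tau> n t" "\<tau> n t \<le> t" "\<bar>\<tau> n t - t\<bar> \<le> 1 / real (Suc n)" for n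
    proof -
      have fl: "real_of_int \<lfloor>real (Suc n) * t\<rfloor> \<le> real (Suc n) * t"
        "real (Suc n) * t - 1 \<le> real_of_int \<lfloor>real (Suc n) * t\<rfloor>" by linarith+
      show "0 \<le> \<tau> n t" using t(2) by (simp add: \<tau>_def)
      show le: "\<tau> n t \<le> t"
        unfolding \<tau>_def using fl(1) by (subst pos_divide_le_eq) (auto simp: mult.commute)
      have "t - \<tau> n t \<le> 1 / real (Suc n)"
      proof -
        have "real (Suc n) * (t - \<tau> n t) = real (Suc n) * t - real_of_int \<lfloor>real (Suc n) * t\<rfloor>"
          by (simp add: \<tau>_def right_diff_distrib del: of_nat_Suc)
        then have "real (Suc n) * (t - \<tau> n t) \<le> 1"
          using fl(2) by linarith
        then show ?thesis by (simp add: pos_le_divide_eq mult.commute del: of_nat_Suc)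
      qed
      then show "\<bar>\<tau> n t - t\<bar> \<le> 1 / real (Suc n)" using le by simp
    qed
    show "(\<lambda>n. D' (\<tau> n (fst z)) (snd z)) \<longlonglongrightarrow> (case z of (t, \<omega>) \<Rightarrow> D' t \<omega>)"
    proof (cases "\<omega> \<in> N")
      case True
      then show ?thesis by (simp add: t(1) D'_def)
    next
      case False
      have "norm (D' (\<tau> n t) \<omega> - D' t \<omega>) \<le> \<bar>C\<bar> * (1 / real (Suc n))" for n
      proof -
        have "\<bar>D (\<tau> n t) \<omega> - D t \<omega>\<bar> \<le> C * \<bar>\<tau> n t - t\<bar>"
          using N(2)[of \<omega> t "\<tau> n t"] t(2,3) False \<tau>(1,2)[of n] by auto
        also have "\<dots> \<le> \<bar>C\<bar> * (1 / real (Suc n))"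
          using \<tau>(3)[of n] by (intro mult_mono) auto
        finally show ?thesis
          using t(2) False \<tau>(1,2)[of n] by (simp add: D'_def)
      qed
      moreover have "(\<lambda>n. \<bar>C\<bar> * (1 / real (Suc n))) \<longlonglongrightarrow> 0"
        using tendsto_mult_right_zero[OF LIMSEQ_inverse_real_of_nat, of "\<bar>C\<bar>"]
        unfolding inverse_eq_divide .
      ultimately have "(\<lambda>n. D' (\<tau> n t) \<omega> - D' t \<omega>) \<longlonglongrightarrow> 0"
        by (rule Lim_null_comparison[OF always_eventually[OF allI]])
      then show ?thesis
        by (simp add: t(1) LIM_zero_iff)
    qed
  qed
  moreover have "AE \<omega> in P. \<forall>t\<in>{0..T}. D' t \<omega> = D t \<omega>"
    using AE_not_in[OF N(1)] by eventually_elim (simp add: D'_def)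
  ultimately show ?thesis by (rule that)
qed

subsection \<open>Wiener integrals and the Brownian filtration\<close>

locale brownian_filtration = prob_space P
  for P :: "'w measure" +
  fixes T :: real and W :: "real \<Rightarrow> 'w \<Rightarrow> real"
  assumes complete: "complete_measure P"
    and brownian: "brownian_motion P (augmented_filtration P W) T W"
begin

section \<open>Measurability in the augmented filtration\<close>

abbreviation A :: "real \<Rightarrow> 'w measure" where "A \<equiv> augmented_filtration P W"

lemma generator_subset:
  "{W s -` S \<inter> space P | s S. s \<in> {0..t} \<and> S \<in> sets borel} \<union> null_sets P \<subseteq> Pow (space P)"
  by (auto dest: null_setsD2 sets.sets_into_space)

lemma space_A [simp]: "space (A t) = space P"
  unfolding augmented_filtration_def using generator_subset by (rule space_measure_of)

lemma sets_A: "sets (A t) = sigma_sets (space P)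
    ({W s -` S \<inter> space P | s S. s \<in> {0..t} \<and> S \<in> sets borel} \<union> null_sets P)"
  unfolding augmented_filtration_def using generator_subset by (rule sets_measure_of)

lemma sets_A_mono: "s \<le> t \<Longrightarrow> sets (A s) \<subseteq> sets (A t)"
  unfolding sets_A by (intro sigma_sets_mono') fastforce

lemma measurable_W: "t \<in> {0..T} \<Longrightarrow> W t \<in> borel_measurable P"
  using brownian by (auto simp: brownian_motion_def)

lemma sets_A_subset: assumes "t \<le> T" shows "sets (A t) \<subseteq> sets P"
  unfolding sets_A using assms
  by (intro sets.sigma_sets_subset) (auto intro!: measurable_sets[OF measurable_W])

lemma measurable_A_mono: "f \<in> borel_measurable (A s) \<Longrightarrow> s \<le> t \<Longrightarrow> f \<in> borel_measurable (A t)"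
  using sets_A_mono[of s t] by (auto simp: measurable_def)

lemma measurable_A_imp: "f \<in> borel_measurable (A t) \<Longrightarrow> t \<le> T \<Longrightarrow> f \<in> borel_measurable P"
  using sets_A_subset[of t] by (auto simp: measurable_def)

lemma W_measurable_A: assumes "0 \<le> s" "s \<le> t" shows "W s \<in> borel_measurable (A t)"
proof (rule measurableI)
  show "W s -` S \<inter> space (A t) \<in> sets (A t)" if "S \<in> sets borel" for S
    unfolding sets_A using assms that by (auto intro!: sigma_sets.Basic)
qed simp

lemma null_sets_in_A: "N \<in> null_sets P \<Longrightarrow> N \<in> sets (A t)"
  unfolding sets_A by (auto intro: sigma_sets.Basic)

text \<open>By completeness every subset of a null set is a null set, and all null sets belong to
  \<open>A t\<close>; hence preimages under \<open>f\<close> and \<open>g\<close> differ only by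
  sets of \<open>A t\<close>.\<close>

lemma measurable_A_cong_AE:
  fixes f g :: "'w \<Rightarrow> real"
  assumes f: "f \<in> borel_measurable (A t)" and ae: "AE \<omega> in P. f \<omega> = g \<omega>"
  shows "g \<in> borel_measurable (A t)"
proof (rule measurableI)
  fix S :: "real set" assume S: "S \<in> sets borel"
  obtain N where N: "N \<in> null_sets P" "{\<omega> \<in> space P. f \<omega> \<noteq> g \<omega>} \<subseteq> N"
    using ae by (auto simp: eventually_ae_filter)
  have "N \<in> sets (A t)" using N(1) by (rule null_sets_in_A)
  moreover have "g -` S \<inter> space P \<inter> N \<in> null_sets P"
    using complete_measure.complete[OF complete, OF _ N(1), of "g -` S \<inter> space P \<inter> N"] N(1)
    by (intro null_sets_subset[OF N(1)]) auto
  then have "g -` S \<inter> space P \<inter> N \<in> sets (A t)" by (rule null_sets_in_A)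
  moreover have "f -` S \<inter> space (A t) \<in> sets (A t)" using f S by (rule measurable_sets)
  ultimately have "(f -` S \<inter> space (A t) - N) \<union> (g -` S \<inter> space P \<inter> N) \<in> sets (A t)" by blast
  moreover have "(f -` S \<inter> space (A t) - N) \<union> (g -` S \<inter> space P \<inter> N) = g -` S \<inter> space (A t)"
    using N(2) by (auto simp: subset_iff)
  ultimately show "g -` S \<inter> space (A t) \<in> sets (A t)" by simp
qed simp

section \<open>Gaussian smoothing by independent increments\<close>

text \<open>The increment is independent of \<open>V\<close>, so integrating it out convolves two
  centred normal densities, and their variances add.\<close>

lemma nn_integral_normal_increment:
  assumes \<sigma>: "0 < \<sigma>" and st: "0 \<le> s" "s < t" "t \<le> T" and V: "V \<in> borel_measurable (A s)"
  shows "(\<integral>\<^sup>+\<omega>. normal_density 0 \<sigma> (V \<omega> + c * (W t \<omega> - W s \<omega>)) \<partial>P)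
       = (\<integral>\<^sup>+\<omega>. normal_density 0 (sqrt (\<sigma>\<^sup>2 + c\<^sup>2 * (t - s))) (V \<omega>) \<partial>P)"
proof (cases "c = 0")
  case True
  then show ?thesis using \<sigma> by simp
next
  case False
  \<comment> \<open>The minus sign gives the argument the form \<open>V - D\<close> required by the
    convolution formula. Since \<open>c\<close> is nonzero, \<open>D\<close> has a normal density;
    for \<open>c = 0\<close> it would be degenerate, hence the case distinction.\<close>
  define D where "D = (\<lambda>\<omega>. - c * (W t \<omega> - W s \<omega>))"
  define \<rho> where "\<rho> = \<bar>c\<bar> * sqrt (t - s)"
  have \<rho>: "0 < \<rho>" "\<rho>\<^sup>2 = c\<^sup>2 * (t - s)"
    using False st by (auto simp: \<rho>_def power_mult_distrib)
  have dist: "distributed P lborel (\<lambda>\<omega>. W t \<omega> - W s \<omega>) (normal_density 0 (sqrt (t - s)))"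
    and indep: "indep_set (sets (A s)) (sets (vimage_algebra (space P) (\<lambda>\<omega>. W t \<omega> - W s \<omega>) borel))"
    using brownian st by (auto simp: brownian_motion_def)
  have distD: "distributed P lborel D (normal_density 0 \<rho>)"
    using normal_density_affine[OF dist, of "- c" 0] False st by (simp add: D_def \<rho>_def)
  have V_P [measurable]: "V \<in> borel_measurable P"
    using V st by (intro measurable_A_imp[OF V]) auto
  have [measurable]: "W t \<in> borel_measurable P" "W s \<in> borel_measurable P"
    using st by (auto intro!: measurable_W)
  have D_P [measurable]: "D \<in> borel_measurable P"
    unfolding D_def by measurable
  have sub1: "sigma_sets (space P) {V -` S \<inter> space P | S. S \<in> sets borel} \<subseteq> sets (A s)"
    using sets.sigma_sets_subset[of "{V -` S \<inter> space P | S. S \<in> sets borel}" "A s"] measurable_sets[OF V]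
    by auto
  have sub2: "sigma_sets (space P) {D -` S \<inter> space P | S. S \<in> sets borel}
      \<subseteq> sets (vimage_algebra (space P) (\<lambda>\<omega>. W t \<omega> - W s \<omega>) borel)" (is "_ \<subseteq> sets ?VA")
  proof -
    have "D -` S \<inter> space P \<in> sets ?VA" if "S \<in> sets borel" for S
    proof -
      have "(\<lambda>x :: real. - c * x) -` S \<inter> space borel \<in> sets borel"
        using that by (intro measurable_sets[of _ borel borel]) auto
      then have "(\<lambda>\<omega>. W t \<omega> - W s \<omega>) -` ((\<lambda>x. - c * x) -` S) \<inter> space P \<in> sets ?VA"
        by (intro in_vimage_algebra) simp
      then show ?thesis by (simp add: D_def vimage_def)
    qed
    then show ?thesis
      using sets.sigma_sets_subset[of "{D -` S \<inter> space P | S. S \<in> sets borel}" ?VA] by auto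
  qed
  have "indep_set (sigma_sets (space P) {V -` S \<inter> space P | S. S \<in> sets borel})
      (sigma_sets (space P) {D -` S \<inter> space P | S. S \<in> sets borel})"
    using indep sub1 sub2 unfolding indep_sets2_eq by blast
  then have "indep_var borel V borel D"
    unfolding indep_var_eq by simp
  then have pair: "distr P (borel \<Otimes>\<^sub>M borel) (\<lambda>\<omega>. (V \<omega>, D \<omega>)) = distr P borel V \<Otimes>\<^sub>M distr P borel D"
    unfolding indep_var_distribution_eq by simp
  interpret D: prob_space "distr P borel D" by (rule prob_space_distr) simp
  have inner: "(\<integral>\<^sup>+y. normal_density 0 \<sigma> (x - y) \<partial>distr P borel D)
      = normal_density 0 (sqrt (\<sigma>\<^sup>2 + \<rho>\<^sup>2)) x" for x
  proof -
    have "(\<integral>\<^sup>+y. normal_density 0 \<sigma> (x - y) \<partial>distr P borel D) = (\<integral>\<^sup>+\<omega>. normal_density 0 \<sigma> (x - D \<omega>) \<partial>P)"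
      by (intro nn_integral_distr) measurable
    also have "\<dots> = (\<integral>\<^sup>+y. ennreal (normal_density 0 \<rho> y) * ennreal (normal_density 0 \<sigma> (x - y)) \<partial>lborel)"
      by (intro distributed_nn_integral[OF distD, symmetric]) measurable
    also have "\<dots> = (\<integral>\<^sup>+y. ennreal (normal_density 0 \<sigma> (x - y) * normal_density 0 \<rho> y) \<partial>lborel)"
      by (simp add: ennreal_mult'[symmetric] mult.commute)
    also have "\<dots> = normal_density 0 (sqrt (\<sigma>\<^sup>2 + \<rho>\<^sup>2)) x"
      using conv_normal_density_zero_mean[OF \<sigma> \<rho>(1)] by (rule fun_cong)
    finally show ?thesis .
  qed
  have "(\<integral>\<^sup>+\<omega>. normal_density 0 \<sigma> (V \<omega> + c * (W t \<omega> - W s \<omega>)) \<partial>P)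
      = (\<integral>\<^sup>+\<omega>. normal_density 0 \<sigma> (fst (V \<omega>, D \<omega>) - snd (V \<omega>, D \<omega>)) \<partial>P)"
    by (simp add: D_def)
  also have "\<dots> = (\<integral>\<^sup>+z. normal_density 0 \<sigma> (fst z - snd z) \<partial>distr P (borel \<Otimes>\<^sub>M borel) (\<lambda>\<omega>. (V \<omega>, D \<omega>)))"
    by (intro nn_integral_distr[symmetric]) measurable
  also have "\<dots> = (\<integral>\<^sup>+x. \<integral>\<^sup>+y. normal_density 0 \<sigma> (x - y) \<partial>distr P borel D \<partial>distr P borel V)"
    unfolding pair by (subst D.nn_integral_fst[symmetric]) (simp_all cong: measurable_cong_sets)
  also have "\<dots> = (\<integral>\<^sup>+\<omega>. normal_density 0 (sqrt (\<sigma>\<^sup>2 + \<rho>\<^sup>2)) (V \<omega>) \<partial>P)"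
    unfolding inner by (intro nn_integral_distr) measurable
  finally show ?thesis unfolding \<rho>(2) .
qed

text \<open>The last increment is peeled off first: all other terms are measurable at its left
  endpoint, so its only trace is a larger \<open>\<sigma>\<close>. For this reason the induction
  generalizes over \<open>\<sigma>\<close>.\<close>

lemma nn_integral_normal_increments:
  fixes \<tau> :: "nat \<Rightarrow> real"
  assumes "0 < \<sigma>" and \<tau>0: "0 \<le> \<tau> 0" and "\<tau> m \<le> T" and "\<And>i. i < m \<Longrightarrow> \<tau> i < \<tau> (Suc i)"
    and V: "V \<in> borel_measurable (A (\<tau> 0))"
  shows "(\<integral>\<^sup>+\<omega>. normal_density 0 \<sigma> (V \<omega> + (\<Sum>i<m. k i * (W (\<tau> (Suc i)) \<omega> - W (\<tau> i) \<omega>))) \<partial>P)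
       = (\<integral>\<^sup>+\<omega>. normal_density 0 (sqrt (\<sigma>\<^sup>2 + (\<Sum>i<m. (k i)\<^sup>2 * (\<tau> (Suc i) - \<tau> i)))) (V \<omega>) \<partial>P)"
  using assms(1,3,4)
proof (induction m arbitrary: \<sigma>)
  case 0
  then show ?case by simp
next
  case (Suc m)
  have \<tau>_le: "\<tau> i \<le> \<tau> j" if "i \<le> j" "j \<le> Suc m" for i j
    using Suc.prems(3) that by (rule lift_Suc_less_imp_le)
  define Y where "Y \<omega> = V \<omega> + (\<Sum>i<m. k i * (W (\<tau> (Suc i)) \<omega> - W (\<tau> i) \<omega>))" for \<omega>
  have Y: "Y \<in> borel_measurable (A (\<tau> m))"
    unfolding Y_def
  proof (intro borel_measurable_add borel_measurable_sum borel_measurable_times borel_measurable_diff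
      borel_measurable_const W_measurable_A)
    show "V \<in> borel_measurable (A (\<tau> m))" using V \<tau>_le[of 0 m] by (auto intro: measurable_A_mono)
    fix i assume "i \<in> {..<m}"
    then show "0 \<le> \<tau> (Suc i)" "\<tau> (Suc i) \<le> \<tau> m" "0 \<le> \<tau> i" "\<tau> i \<le> \<tau> m"
      using \<tau>_le[of 0 i] \<tau>_le[of 0 "Suc i"] \<tau>_le[of i m] \<tau>_le[of "Suc i" m] \<tau>0 by auto
  qed
  define \<sigma>' where "\<sigma>' = sqrt (\<sigma>\<^sup>2 + (k m)\<^sup>2 * (\<tau> (Suc m) - \<tau> m))"
  have "\<sigma>\<^sup>2 + (k m)\<^sup>2 * (\<tau> (Suc m) - \<tau> m) > 0"
    using Suc.prems(1) Suc.prems(3)[of m] by (intro add_pos_nonneg) auto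
  then have \<sigma>': "0 < \<sigma>'" "\<sigma>'\<^sup>2 = \<sigma>\<^sup>2 + (k m)\<^sup>2 * (\<tau> (Suc m) - \<tau> m)"
    by (auto simp: \<sigma>'_def)
  have "(\<integral>\<^sup>+\<omega>. normal_density 0 \<sigma> (V \<omega> + (\<Sum>i<Suc m. k i * (W (\<tau> (Suc i)) \<omega> - W (\<tau> i) \<omega>))) \<partial>P)
      = (\<integral>\<^sup>+\<omega>. normal_density 0 \<sigma> (Y \<omega> + k m * (W (\<tau> (Suc m)) \<omega> - W (\<tau> m) \<omega>)) \<partial>P)"
    by (simp add: Y_def add.assoc)
  also have "\<dots> = (\<integral>\<^sup>+\<omega>. normal_density 0 \<sigma>' (Y \<omega>) \<partial>P)"
    unfolding \<sigma>'_def using Suc.prems \<tau>0 \<tau>_le[of 0 m]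
    by (intro nn_integral_normal_increment Y) auto
  also have "\<dots> = (\<integral>\<^sup>+\<omega>. normal_density 0
      (sqrt (\<sigma>'\<^sup>2 + (\<Sum>i<m. (k i)\<^sup>2 * (\<tau> (Suc i) - \<tau> i)))) (V \<omega>) \<partial>P)"
    unfolding Y_def using Suc.prems \<tau>_le[of m "Suc m"] by (intro Suc.IH \<sigma>'(1)) auto
  finally show ?case unfolding \<sigma>'(2) by (simp add: ac_simps)
qed

text \<open>After the increments are absorbed, the density has variance at least \<open>q\<close>
  and is bounded by its peak value. The bound is thus uniform in \<open>V\<close> and
  \<open>\<sigma>\<close>, which allows \<open>\<sigma>\<close> to be chosen as small as the
  ball.\<close>

lemma nn_integral_normal_step_le:
  assumes \<sigma>: "0 < \<sigma>" and st: "0 \<le> s" "s < t" "t \<le> T" and V: "V \<in> borel_measurable (A s)"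
    and p: "\<forall>(c, a, b)\<in>set p. 0 \<le> a \<and> a \<le> b \<and> b \<le> t"
    and q: "0 < q" "ennreal q \<le> (\<integral>\<^sup>+r\<in>{s<..t}. ennreal ((step_fun p r)\<^sup>2) \<partial>lborel)"
  shows "(\<integral>\<^sup>+\<omega>. normal_density 0 \<sigma>
      (V \<omega> + (\<Sum>(c, a, b)\<leftarrow>p. c * (W (max s b) \<omega> - W (max s a) \<omega>))) \<partial>P)
    \<le> ennreal (1 / sqrt (2 * pi * q))"
proof -
  obtain \<tau> m where \<tau>: "\<tau> 0 = s" "\<tau> m = t" "\<And>i. i < m \<Longrightarrow> \<tau> i < \<tau> (Suc i)"
    "\<And>i r. i < m \<Longrightarrow> r \<in> {\<tau> i<..\<tau> (Suc i)} \<Longrightarrow> step_fun p r = step_fun p (\<tau> (Suc i))"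
    "\<And>w :: real \<Rightarrow> real. (\<Sum>(c, a, b)\<leftarrow>p. c * (w (max s b) - w (max s a)))
       = (\<Sum>i<m. step_fun p (\<tau> (Suc i)) * (w (\<tau> (Suc i)) - w (\<tau> i)))"
    by (rule step_fun_grid[OF p st(2)], rule that)
  define v where "v = (\<Sum>i<m. (step_fun p (\<tau> (Suc i)))\<^sup>2 * (\<tau> (Suc i) - \<tau> i))"
  have "(\<integral>\<^sup>+r\<in>{\<tau> 0<..\<tau> m}. ennreal ((step_fun p r)\<^sup>2) \<partial>lborel) = ennreal v"
    unfolding v_def
  proof (rule nn_integral_piecewise_const)
    show "(step_fun p r)\<^sup>2 = (step_fun p (\<tau> (Suc i)))\<^sup>2" if "i < m" "r \<in> {\<tau> i<..\<tau> (Suc i)}" for i r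
      using \<tau>(4)[OF that] by simp
  qed (use \<tau>(3) in auto)
  moreover have "0 \<le> v"
    unfolding v_def using \<tau>(3) by (intro sum_nonneg) (auto simp: less_imp_le)
  ultimately have qv: "q \<le> v" using q \<tau>(1,2) by simp
  have le: "normal_density 0 (sqrt (\<sigma>\<^sup>2 + v)) x \<le> 1 / sqrt (2 * pi * q)" for x
  proof -
    have "normal_density 0 (sqrt (\<sigma>\<^sup>2 + v)) x \<le> 1 / sqrt (2 * pi * (\<sigma>\<^sup>2 + v))"
      using \<open>0 \<le> v\<close> by (simp add: normal_density_def divide_right_mono)
    also have "\<dots> \<le> 1 / sqrt (2 * pi * q)"
    proof -
      have "q \<le> \<sigma>\<^sup>2 + v" using qv by (simp add: add_increasing)
      then have "sqrt (2 * pi * q) \<le> sqrt (2 * pi * (\<sigma>\<^sup>2 + v))" by simp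
      then show ?thesis using q by (intro frac_le) auto
    qed
    finally show ?thesis .
  qed
  have eq: "(\<Sum>(c, a, b)\<leftarrow>p. c * (W (max s b) \<omega> - W (max s a) \<omega>))
      = (\<Sum>i<m. step_fun p (\<tau> (Suc i)) * (W (\<tau> (Suc i)) \<omega> - W (\<tau> i) \<omega>))" for \<omega>
    by (rule \<tau>(5))
  have "(\<integral>\<^sup>+\<omega>. normal_density 0 \<sigma>
      (V \<omega> + (\<Sum>(c, a, b)\<leftarrow>p. c * (W (max s b) \<omega> - W (max s a) \<omega>))) \<partial>P)
    = (\<integral>\<^sup>+\<omega>. normal_density 0 (sqrt (\<sigma>\<^sup>2 + v)) (V \<omega>) \<partial>P)"
    unfolding eq v_def using \<sigma> st V \<tau>(1-3) by (intro nn_integral_normal_increments) auto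
  also have "\<dots> \<le> (\<integral>\<^sup>+\<omega>. ennreal (1 / sqrt (2 * pi * q)) \<partial>P)"
    using le by (intro nn_integral_mono ennreal_leI)
  finally show ?thesis by (simp add: emeasure_space_1)
qed

section \<open>Splitting Wiener integrals in time and small-ball bounds\<close>

text \<open>The map \<open>g\<close> is the identity for a whole step integral and
  \<open>min s\<close> for its part before time \<open>s\<close>.\<close>

lemma sum_list_increments_measurable:
  assumes "\<forall>(c, a, b)\<in>set p. g a \<in> {0..s} \<and> g b \<in> {0..s}"
  shows "(\<lambda>\<omega>. \<Sum>(c, a, b)\<leftarrow>p. c * (W (g b) \<omega> - W (g a) \<omega>)) \<in> borel_measurable (A s)"
  using assms
proof (induction p)
  case (Cons x p)
  obtain c a b where x: "x = (c, a, b)" by (cases x)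
  have "W (g a) \<in> borel_measurable (A s)" "W (g b) \<in> borel_measurable (A s)"
    using Cons.prems by (auto simp: x intro!: W_measurable_A)
  then show ?case using Cons by (simp add: x)
qed simp

lemma step_wiener_integral_measurable:
  assumes "\<forall>(c, a, b)\<in>set p. 0 \<le> a \<and> a \<le> b \<and> b \<le> t"
  shows "step_wiener_integral W p \<in> borel_measurable (A t)"
  unfolding step_wiener_integral_def[abs_def] using assms
  by (intro sum_list_increments_measurable[where g = "\<lambda>x. x"]) auto

text \<open>For each endpoint \<open>x\<close>, the values of \<open>W\<close> at
  \<open>min s x\<close> and \<open>max s x\<close> sum to those at \<open>s\<close> and
  \<open>x\<close>; in a difference the value at \<open>s\<close> cancels.\<close>

lemma step_wiener_integral_split:
  "step_wiener_integral W p \<omega> = (\<Sum>(c, a, b)\<leftarrow>p. c * (W (min s b) \<omega> - W (min s a) \<omega>))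
     + (\<Sum>(c, a, b)\<leftarrow>p. c * (W (max s b) \<omega> - W (max s a) \<omega>))"
proof -
  have eq: "c * (W b \<omega> - W a \<omega>) =
      c * (W (min s b) \<omega> - W (min s a) \<omega>) + c * (W (max s b) \<omega> - W (max s a) \<omega>)" for a b c
    by (simp add: min_def max_def algebra_simps)
  have "step_wiener_integral W p \<omega> = (\<Sum>(c, a, b)\<leftarrow>p. c * (W (min s b) \<omega> - W (min s a) \<omega>)
      + c * (W (max s b) \<omega> - W (max s a) \<omega>))"
    unfolding step_wiener_integral_def by (intro arg_cong[where f = sum_list] map_cong refl prod.case_cong eq)
  also have "\<dots> = (\<Sum>(c, a, b)\<leftarrow>p. c * (W (min s b) \<omega> - W (min s a) \<omega>))
     + (\<Sum>(c, a, b)\<leftarrow>p. c * (W (max s b) \<omega> - W (max s a) \<omega>))"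
    unfolding case_prod_unfold by (rule sum_list_addf)
  finally show ?thesis .
qed

text \<open>
  Here \<open>s\<close> splits the approximating step integrals into a part measurable at time \<open>s\<close>, which is
  absorbed into \<open>U\<close>, and a part over \<open>(s, t]\<close>, which carries the variance \<open>q\<close>.
\<close>

lemma wiener_integral_small_ball:
  assumes Y: "has_wiener_integral P W t f Y"
    and f: "f \<in> borel_measurable (restrict_space borel {0..t})"
    and st: "0 \<le> s" "s < t" "t \<le> T" and U: "U \<in> borel_measurable (A s)"
    and \<delta>: "0 < \<delta>" and C: "0 \<le> C" and q: "0 < q"
    and var: "ennreal (4 * q) \<le> (\<integral>\<^sup>+r\<in>{s<..t}. ennreal ((f r)\<^sup>2) \<partial>lborel)"
  shows "emeasure P {\<omega> \<in> space P. \<bar>U \<omega> + Y \<omega>\<bar> \<le> C * \<delta>} \<le> ennreal (\<delta> + \<delta> * exp ((C + 1)\<^sup>2 / 2) / sqrt q)"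
proof -
  obtain p where p: "\<And>n. \<forall>(c, a, b)\<in>set (p n). 0 \<le> a \<and> a \<le> b \<and> b \<le> t"
    and lim1: "(\<lambda>n. \<integral>\<^sup>+r\<in>{0..t}. ennreal ((f r - step_fun (p n) r)\<^sup>2) \<partial>lborel) \<longlonglongrightarrow> 0"
    and lim2: "(\<lambda>n. \<integral>\<^sup>+\<omega>. ennreal ((Y \<omega> - step_wiener_integral W (p n) \<omega>)\<^sup>2) \<partial>P) \<longlonglongrightarrow> 0"
    and Y_meas [measurable]: "Y \<in> borel_measurable P"
    using Y unfolding has_wiener_integral_def by blast
  \<comment> \<open>One step function is fixed. Error \<open>q\<close> in the integrand still leaves
    variance \<open>q\<close> of the given \<open>4 * q\<close>, because squares of sums cost a
    factor 2; error \<open>\<delta> ^ 3\<close> in the integral makes Chebyshev at level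
    \<open>\<delta>\<close> cost at most \<open>\<delta>\<close>.\<close>
  have "eventually (\<lambda>n. (\<integral>\<^sup>+r\<in>{0..t}. ennreal ((f r - step_fun (p n) r)\<^sup>2) \<partial>lborel) < ennreal q \<and>
      (\<integral>\<^sup>+\<omega>. ennreal ((Y \<omega> - step_wiener_integral W (p n) \<omega>)\<^sup>2) \<partial>P) < ennreal (\<delta> ^ 3)) sequentially"
    using q \<delta> by (intro eventually_conj order_tendstoD(2)[OF lim1] order_tendstoD(2)[OF lim2]) auto
  then obtain n where n1: "(\<integral>\<^sup>+r\<in>{0..t}. ennreal ((f r - step_fun (p n) r)\<^sup>2) \<partial>lborel) < ennreal q"
    and n2: "(\<integral>\<^sup>+\<omega>. ennreal ((Y \<omega> - step_wiener_integral W (p n) \<omega>)\<^sup>2) \<partial>P) < ennreal (\<delta> ^ 3)"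
    by (auto simp: eventually_sequentially)
  define h where "h = step_fun (p n)"
  define S where "S = step_wiener_integral W (p n)"
  have S_meas [measurable]: "S \<in> borel_measurable P"
    unfolding S_def using step_wiener_integral_measurable[OF p] st(3) by (rule measurable_A_imp)
  have U_meas [measurable]: "U \<in> borel_measurable P"
    using U st by (intro measurable_A_imp[OF U]) auto
  \<comment> \<open>The integrand is measurable only on \<open>[0, t]\<close>; extension by zero
    makes it Borel on the whole line.\<close>
  define f' where "f' r = f r * indicator {0..t} r" for r
  have f' [measurable]: "f' \<in> borel_measurable borel"
    using f unfolding f'_def[abs_def] by (subst (asm) borel_measurable_restrict_space_iff) (auto simp: mult.commute)
  have h [measurable]: "h \<in> borel_measurable borel" unfolding h_def by simp
  have var_h: "ennreal q \<le> (\<integral>\<^sup>+r\<in>{s<..t}. ennreal ((h r)\<^sup>2) \<partial>lborel)" (is "_ \<le> ?H")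
  proof -
    have sq: "x\<^sup>2 \<le> 2 * (x - y)\<^sup>2 + 2 * y\<^sup>2" for x y :: real
      using zero_le_power2[of "x - 2 * y"] by (simp add: power2_eq_square algebra_simps)
    have "ennreal (4 * q) \<le> (\<integral>\<^sup>+r. 2 * (ennreal ((f' r - h r)\<^sup>2) * indicator {0..t} r)
        + 2 * (ennreal ((h r)\<^sup>2) * indicator {s<..t} r) \<partial>lborel)"
    proof (rule order_trans[OF var], rule nn_integral_mono)
      fix r
      have "ennreal ((f r)\<^sup>2) \<le> 2 * ennreal ((f r - h r)\<^sup>2) + 2 * ennreal ((h r)\<^sup>2)"
        using ennreal_leI[OF sq[of "f r" "h r"]] by (simp add: ennreal_plus ennreal_mult)
      then show "ennreal ((f r)\<^sup>2) * indicator {s<..t} r \<le> 2 * (ennreal ((f' r - h r)\<^sup>2) * indicator {0..t} r)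
        + 2 * (ennreal ((h r)\<^sup>2) * indicator {s<..t} r)"
        using st by (auto simp: f'_def split: split_indicator)
    qed
    also have "\<dots> = 2 * (\<integral>\<^sup>+r\<in>{0..t}. ennreal ((f' r - h r)\<^sup>2) \<partial>lborel) + 2 * ?H"
      by (subst nn_integral_add) (auto simp: nn_integral_cmult)
    also have "(\<integral>\<^sup>+r\<in>{0..t}. ennreal ((f' r - h r)\<^sup>2) \<partial>lborel) = (\<integral>\<^sup>+r\<in>{0..t}. ennreal ((f r - h r)\<^sup>2) \<partial>lborel)"
      by (intro nn_integral_cong) (auto simp: f'_def split: split_indicator)
    also have "2 * \<dots> + 2 * ?H \<le> 2 * ennreal q + 2 * ?H"
      using n1 unfolding h_def by (intro add_right_mono mult_left_mono) auto
    finally have le: "ennreal (4 * q) \<le> 2 * ennreal q + 2 * ?H" .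
    show ?thesis
    proof (cases "?H = \<infinity>")
      case False
      then obtain x where x: "?H = ennreal x" "0 \<le> x"
        by (cases ?H rule: ennreal_cases) simp_all
      have "ennreal (4 * q) \<le> ennreal (2 * q + 2 * x)"
        using le q x(2) unfolding x(1) by (simp add: ennreal_plus ennreal_mult)
      then have "q \<le> x"
        using q x(2) by (subst (asm) ennreal_le_iff) auto
      then show ?thesis
        unfolding x(1) by (rule ennreal_leI)
    next
      case True
      show ?thesis unfolding True by simp
    qed
  qed
  define V where "V \<omega> = U \<omega> + (\<Sum>(c, a, b)\<leftarrow>p n. c * (W (min s b) \<omega> - W (min s a) \<omega>))" for \<omega>
  have V: "V \<in> borel_measurable (A s)"
    unfolding V_def[abs_def] using U p[of n] st
    by (intro borel_measurable_add sum_list_increments_measurable[where g = "min s"]) auto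
  have US: "U \<omega> + S \<omega> = V \<omega> + (\<Sum>(c, a, b)\<leftarrow>p n. c * (W (max s b) \<omega> - W (max s a) \<omega>))" for \<omega>
    unfolding S_def step_wiener_integral_split[of "p n" \<omega> s] V_def by simp
  have int_le: "(\<integral>\<^sup>+\<omega>. normal_density 0 \<delta> (U \<omega> + S \<omega>) \<partial>P) \<le> ennreal (1 / sqrt (2 * pi * q))"
    unfolding US using var_h unfolding h_def
    by (intro nn_integral_normal_step_le[OF \<delta> st V p q])
  \<comment> \<open>If \<open>U + Y\<close> is small, then either the step integral \<open>S\<close>
    is far from \<open>Y\<close> (\<open>E1\<close>), or \<open>U + S\<close> lies in a ball
    enlarged by \<open>\<delta>\<close> (\<open>E2\<close>).\<close>
  define E1 where "E1 = {\<omega> \<in> space P. \<delta> \<le> \<bar>Y \<omega> - S \<omega>\<bar>}"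
  define E2 where "E2 = {\<omega> \<in> space P. \<bar>U \<omega> + S \<omega>\<bar> \<le> (C + 1) * \<delta>}"
  have [measurable]: "E1 \<in> sets P" "E2 \<in> sets P" unfolding E1_def E2_def by measurable
  have "emeasure P {\<omega> \<in> space P. \<bar>U \<omega> + Y \<omega>\<bar> \<le> C * \<delta>} \<le> emeasure P (E1 \<union> E2)"
  proof (rule emeasure_mono)
    show "{\<omega> \<in> space P. \<bar>U \<omega> + Y \<omega>\<bar> \<le> C * \<delta>} \<subseteq> E1 \<union> E2"
      by (auto simp: E1_def E2_def algebra_simps)
  qed measurable
  also have "\<dots> \<le> emeasure P E1 + emeasure P E2"
    by (intro emeasure_subadditive) auto
  also have "emeasure P E1 \<le> ennreal \<delta>"
  proof -
    have "emeasure P E1 \<le> emeasure P {\<omega> \<in> space P. 1 \<le> ennreal (1 / \<delta>\<^sup>2) * ennreal ((Y \<omega> - S \<omega>)\<^sup>2)}"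
    proof (rule emeasure_mono)
      show "E1 \<subseteq> {\<omega> \<in> space P. 1 \<le> ennreal (1 / \<delta>\<^sup>2) * ennreal ((Y \<omega> - S \<omega>)\<^sup>2)}"
      proof
        fix \<omega> assume "\<omega> \<in> E1"
        then have "\<omega> \<in> space P" "\<delta> \<le> \<bar>Y \<omega> - S \<omega>\<bar>"
          by (auto simp: E1_def)
        then have "\<omega> \<in> space P" "\<delta>\<^sup>2 \<le> \<bar>Y \<omega> - S \<omega>\<bar>\<^sup>2"
          using \<delta> power_mono[of \<delta> "\<bar>Y \<omega> - S \<omega>\<bar>" 2] by auto
        then show "\<omega> \<in> {\<omega> \<in> space P. 1 \<le> ennreal (1 / \<delta>\<^sup>2) * ennreal ((Y \<omega> - S \<omega>)\<^sup>2)}"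
          using \<delta> by (simp add: ennreal_mult[symmetric] ennreal_1[symmetric] del: ennreal_1)
      qed
    qed measurable
    also have "\<dots> \<le> ennreal (1 / \<delta>\<^sup>2) * (\<integral>\<^sup>+\<omega>. ennreal ((Y \<omega> - S \<omega>)\<^sup>2) * indicator (space P) \<omega> \<partial>P)"
      by (rule nn_integral_Markov_inequality) auto
    also have "\<dots> = ennreal (1 / \<delta>\<^sup>2) * (\<integral>\<^sup>+\<omega>. ennreal ((Y \<omega> - S \<omega>)\<^sup>2) \<partial>P)"
      by (simp cong: nn_integral_cong)
    also have "\<dots> \<le> ennreal (1 / \<delta>\<^sup>2) * ennreal (\<delta> ^ 3)"
      using n2 unfolding S_def by (intro mult_left_mono) auto
    also have "\<dots> = ennreal \<delta>"
      using \<delta> by (simp add: ennreal_mult[symmetric] power2_eq_square power3_eq_cube)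
    finally show ?thesis .
  qed
  also have "emeasure P E2 \<le> ennreal (\<delta> * exp ((C + 1)\<^sup>2 / 2) / sqrt q)"
  proof -
    \<comment> \<open>This is the least value on the ball in \<open>E2\<close> of the normal density
      with deviation \<open>\<delta>\<close>. Hence the density divided by \<open>d\<close> is at
      least 1 on \<open>E2\<close>, and Markov's inequality turns \<open>int_le\<close> into a bound
      on its probability.\<close>
    define d where "d = normal_density 0 \<delta> ((C + 1) * \<delta>)"
    have d: "0 < d" unfolding d_def using \<delta> by (rule normal_density_pos)
    have d_eq: "1 / d = sqrt (2 * pi) * \<delta> * exp ((C + 1)\<^sup>2 / 2)"
    proof -
      have "((C + 1) * \<delta>)\<^sup>2 / (2 * \<delta>\<^sup>2) = (C + 1)\<^sup>2 / 2"
        using \<delta> by (simp add: power_mult_distrib)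
      then show ?thesis
        using \<delta> by (simp add: d_def normal_density_def exp_minus real_sqrt_mult field_simps)
    qed
    have "emeasure P E2 \<le> emeasure P {\<omega> \<in> space P. 1 \<le> ennreal (1 / d) * ennreal (normal_density 0 \<delta> (U \<omega> + S \<omega>))}"
    proof (rule emeasure_mono)
      show "E2 \<subseteq> {\<omega> \<in> space P. 1 \<le> ennreal (1 / d) * ennreal (normal_density 0 \<delta> (U \<omega> + S \<omega>))}"
      proof
        fix \<omega> assume "\<omega> \<in> E2"
        then have \<omega>: "\<omega> \<in> space P" "\<bar>U \<omega> + S \<omega>\<bar> \<le> \<bar>(C + 1) * \<delta>\<bar>"
          using \<delta> C by (auto simp: E2_def)
        have "(U \<omega> + S \<omega>)\<^sup>2 \<le> ((C + 1) * \<delta>)\<^sup>2"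
          using \<omega>(2) by (simp only: abs_le_square_iff)
        then have "- ((C + 1) * \<delta>)\<^sup>2 / (2 * \<delta>\<^sup>2) \<le> - (U \<omega> + S \<omega>)\<^sup>2 / (2 * \<delta>\<^sup>2)"
          using \<delta> by (intro divide_right_mono) auto
        then have "d \<le> normal_density 0 \<delta> (U \<omega> + S \<omega>)"
          unfolding d_def normal_density_def by (intro mult_left_mono) auto
        then show "\<omega> \<in> {\<omega> \<in> space P. 1 \<le> ennreal (1 / d) * ennreal (normal_density 0 \<delta> (U \<omega> + S \<omega>))}"
          using d \<omega>(1) by (simp add: ennreal_mult[symmetric] ennreal_1[symmetric] del: ennreal_1)
      qed
    qed measurable
    also have "\<dots> \<le> ennreal (1 / d) * (\<integral>\<^sup>+\<omega>. ennreal (normal_density 0 \<delta> (U \<omega> + S \<omega>)) * indicator (space P) \<omega> \<partial>P)"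
      by (rule nn_integral_Markov_inequality) auto
    also have "\<dots> = ennreal (1 / d) * (\<integral>\<^sup>+\<omega>. ennreal (normal_density 0 \<delta> (U \<omega> + S \<omega>)) \<partial>P)"
      by (simp cong: nn_integral_cong)
    also have "\<dots> \<le> ennreal (1 / d) * ennreal (1 / sqrt (2 * pi * q))"
      using int_le by (intro mult_left_mono) auto
    also have "\<dots> = ennreal (\<delta> * exp ((C + 1)\<^sup>2 / 2) / sqrt q)"
      unfolding d_eq using \<delta> q by (simp add: ennreal_mult[symmetric] real_sqrt_mult)
    finally show ?thesis .
  qed
  finally show ?thesis
    using \<delta> q by (simp add: ennreal_plus add_mono)
qed

text \<open>The definition asks only for measurability with respect to \<open>P\<close>. A
  subsequence of the approximating step integrals, which are measurable at time \<open>t\<close>,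
  converges almost surely, and the filtration contains all null sets.\<close>

lemma wiener_integral_measurable:
  assumes Y: "has_wiener_integral P W t f Y" and t: "t \<le> T"
  shows "Y \<in> borel_measurable (A t)"
proof -
  obtain p where p: "\<And>n. \<forall>(c, a, b)\<in>set (p n). 0 \<le> a \<and> a \<le> b \<and> b \<le> t"
    and lim: "(\<lambda>n. \<integral>\<^sup>+\<omega>. ennreal ((Y \<omega> - step_wiener_integral W (p n) \<omega>)\<^sup>2) \<partial>P) \<longlonglongrightarrow> 0"
    and Y_meas [measurable]: "Y \<in> borel_measurable P"
    using Y unfolding has_wiener_integral_def by blast
  have S_meas: "step_wiener_integral W (p n) \<in> borel_measurable (A t)" for n
    using p by (rule step_wiener_integral_measurable)
  have S_meas' [measurable]: "step_wiener_integral W (p n) \<in> borel_measurable P" for n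
    using S_meas t by (rule measurable_A_imp)
  \<comment> \<open>The errors are known to be finite only eventually; the index is therefore
    shifted by \<open>N\<close> to make every \<open>u n\<close> integrable.\<close>
  have "eventually (\<lambda>n. (\<integral>\<^sup>+\<omega>. ennreal ((Y \<omega> - step_wiener_integral W (p n) \<omega>)\<^sup>2) \<partial>P) < 1) sequentially"
    by (rule order_tendstoD(2)[OF lim]) simp
  then obtain N where N: "\<And>n. n \<ge> N \<Longrightarrow> (\<integral>\<^sup>+\<omega>. ennreal ((Y \<omega> - step_wiener_integral W (p n) \<omega>)\<^sup>2) \<partial>P) < 1"
    by (auto simp: eventually_sequentially)
  define u where "u n \<omega> = (Y \<omega> - step_wiener_integral W (p (n + N)) \<omega>)\<^sup>2" for n \<omega>
  have u_meas [measurable]: "u n \<in> borel_measurable P" for n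
    unfolding u_def by measurable
  have u_int: "integrable P (u n)" for n
  proof (rule integrableI_nonneg)
    show "(\<integral>\<^sup>+\<omega>. ennreal (u n \<omega>) \<partial>P) < \<infinity>"
      unfolding u_def by (rule less_trans[OF N]) auto
  qed (auto simp: u_def)
  have "(\<lambda>n. \<integral>\<^sup>+\<omega>. ennreal (u n \<omega>) \<partial>P) \<longlonglongrightarrow> 0"
    unfolding u_def using lim by (rule LIMSEQ_ignore_initial_segment)
  moreover have "(\<integral>\<^sup>+\<omega>. ennreal (u n \<omega>) \<partial>P) = ennreal (\<integral>\<omega>. norm (u n \<omega>) \<partial>P)" for n
  proof -
    have "norm (u n \<omega>) = u n \<omega>" "0 \<le> u n \<omega>" for \<omega> by (simp_all add: u_def)
    then show ?thesis using nn_integral_eq_integral[OF u_int[of n]] by simp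
  qed
  ultimately have "(\<lambda>n. \<integral>\<omega>. norm (u n \<omega>) \<partial>P) \<longlonglongrightarrow> 0"
    by (simp add: tendsto_ennreal_iff[of _ _ 0, simplified])
  from tendsto_L1_AE_subseq[OF u_int this]
  obtain r where r: "AE \<omega> in P. (\<lambda>n. u (r n) \<omega>) \<longlonglongrightarrow> 0"
    by blast
  define S where "S n = step_wiener_integral W (p (r n + N))" for n
  have "AE \<omega> in P. lim (\<lambda>n. S n \<omega>) = Y \<omega>"
    using r
  proof eventually_elim
    case (elim \<omega>)
    have "(\<lambda>n. sqrt (u (r n) \<omega>)) \<longlonglongrightarrow> sqrt 0"
      using elim by (rule tendsto_real_sqrt)
    then have "(\<lambda>n. \<bar>Y \<omega> - S n \<omega>\<bar>) \<longlonglongrightarrow> 0"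
      by (simp add: u_def S_def)
    then have "(\<lambda>n. Y \<omega> - S n \<omega>) \<longlonglongrightarrow> 0"
      by (rule tendsto_rabs_zero_cancel)
    then have "(\<lambda>n. Y \<omega> - (Y \<omega> - S n \<omega>)) \<longlonglongrightarrow> Y \<omega> - 0"
      by (intro tendsto_diff tendsto_const)
    then show "lim (\<lambda>n. S n \<omega>) = Y \<omega>"
      by (intro limI) simp
  qed
  moreover have "(\<lambda>\<omega>. lim (\<lambda>n. S n \<omega>)) \<in> borel_measurable (A t)"
    unfolding S_def by (intro borel_measurable_lim_metric S_meas)
  ultimately show ?thesis by (rule measurable_A_cong_AE[rotated])
qed

end

subsection \<open>Volterra equations\<close>

locale volterra_sde = brownian_filtration P T W
  for P :: "'w measure" and T :: real and W :: "real \<Rightarrow> 'w \<Rightarrow> real" +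
  fixes K :: "real \<Rightarrow> real \<Rightarrow> real" and B :: "real \<Rightarrow> 'w \<Rightarrow> real" and H c :: real and M :: "real set"
  assumes kernel: "L2_kernel T K"
    and process: "volterra_process P T W K B"
    and H: "H < 1" and c: "0 < c"
    and lower: "\<And>t \<epsilon>. t \<in> {0<..T} \<Longrightarrow> \<epsilon> \<in> {0<..<t} \<Longrightarrow>
           c * \<epsilon> powr H \<le> sqrt (LINT s:{t - \<epsilon>..t}|lborel. (K t s)\<^sup>2)"
    and countable_compl: "countable (UNIV - M)"
begin

section \<open>Measurability and variance of the Volterra kernel\<close>

lemma wiener: "t \<in> {0..T} \<Longrightarrow> has_wiener_integral P W t (K t) (B t)"
  and B_joint: "(\<lambda>(t, \<omega>). B t \<omega>) \<in> borel_measurable (restrict_space borel {0..T} \<Otimes>\<^sub>M P)"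
  using process by (auto simp: volterra_process_def)

lemma B_measurable: "t \<in> {0..T} \<Longrightarrow> B t \<in> borel_measurable (A t)"
  using wiener_integral_measurable[OF wiener] by simp

lemma kernel_section_measurable:
  assumes "t \<in> {0..T}"
  shows "K t \<in> borel_measurable (restrict_space borel {0..t})"
proof -
  have "(\<lambda>(t, s). K t s) \<in> borel_measurable (restrict_space borel {0..T} \<Otimes>\<^sub>M restrict_space borel {0..T})"
    using kernel by (simp add: L2_kernel_def)
  moreover have "(\<lambda>s. (t, s)) \<in> measurable (restrict_space borel {0..T}) (restrict_space borel {0..T} \<Otimes>\<^sub>M restrict_space borel {0..T})"
    using assms by (intro measurable_Pair1') simp
  ultimately have "(\<lambda>s. case (t, s) of (t, s) \<Rightarrow> K t s) \<in> borel_measurable (restrict_space borel {0..T})"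
    by (rule measurable_compose[rotated])
  then show ?thesis
    using assms by (auto intro: measurable_restrict_mono[of "K t" borel "{0..T}" borel "{0..t}"])
qed

lemma M_borel [measurable]: "M \<in> sets borel"
proof -
  have "UNIV - M \<in> sets borel" using countable_compl by (rule sets.countable[rotated]) simp
  then have "space borel - (UNIV - M) \<in> sets borel" by (rule sets.compl_sets)
  moreover have "space borel - (UNIV - M) = M" by auto
  ultimately show ?thesis by (simp only:)
qed

text \<open>Square integrability of \<open>K t\<close> allows the passage from the Bochner integral
  in \<open>lower\<close> to a nonnegative one; replacing the closed interval by a half-open one
  costs a Lebesgue-null point.\<close>

lemma kernel_variance_lower:
  assumes t: "t \<in> {0<..T}" and \<epsilon>: "\<epsilon> \<in> {0<..<t}"
  shows "ennreal ((c * \<epsilon> powr H)\<^sup>2) \<le> (\<integral>\<^sup>+r\<in>{t - \<epsilon><..t}. ennreal ((K t r)\<^sup>2) \<partial>lborel)"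
proof -
  have "set_integrable lborel {0..t} (\<lambda>s. (K t s)\<^sup>2)"
    using kernel t by (auto simp: L2_kernel_def)
  then have int: "set_integrable lborel {t - \<epsilon>..t} (\<lambda>s. (K t s)\<^sup>2)"
    by (rule set_integrable_subset) (use \<epsilon> in auto)
  have "0 \<le> (LINT s:{t - \<epsilon>..t}|lborel. (K t s)\<^sup>2)"
    unfolding set_lebesgue_integral_def by (intro Bochner_Integration.integral_nonneg) simp
  then have "(c * \<epsilon> powr H)\<^sup>2 \<le> (LINT s:{t - \<epsilon>..t}|lborel. (K t s)\<^sup>2)"
    using power_mono[OF lower[OF t \<epsilon>], of 2] c by simp
  then have "ennreal ((c * \<epsilon> powr H)\<^sup>2) \<le> ennreal (LINT s:{t - \<epsilon>..t}|lborel. (K t s)\<^sup>2)"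
    by (rule ennreal_leI)
  also have "\<dots> = (\<integral>\<^sup>+s. ennreal (indicator {t - \<epsilon>..t} s *\<^sub>R (K t s)\<^sup>2) \<partial>lborel)"
    using int unfolding set_lebesgue_integral_def set_integrable_def
    by (intro nn_integral_eq_integral[symmetric]) auto
  also have "\<dots> = (\<integral>\<^sup>+r\<in>{t - \<epsilon><..t}. ennreal ((K t r)\<^sup>2) \<partial>lborel)"
    using AE_lborel_singleton[of "t - \<epsilon>"]
    by (intro nn_integral_cong_AE, eventually_elim) (auto split: split_indicator)
  finally show ?thesis .
qed

section \<open>Absence of atoms at positive times\<close>

lemma AE_neq_point:
  assumes t: "t \<in> {0<..T}" and X: "adapted A T X" and C: "0 \<le> C"
    and lip: "AE \<omega> in P. \<forall>s\<in>{0..T}. \<forall>t\<in>{0..T}. \<bar>(X t \<omega> - B t \<omega>) - (X s \<omega> - B s \<omega>)\<bar> \<le> C * \<bar>t - s\<bar>"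
  shows "AE \<omega> in P. X t \<omega> \<noteq> x"
proof -
  have Xt [measurable]: "X t \<in> borel_measurable P"
    using X t by (intro measurable_A_imp[of "X t" t]) (auto simp: adapted_def)
  define E where "E = {\<omega> \<in> space P. X t \<omega> = x}"
  have E [measurable]: "E \<in> sets P" unfolding E_def by measurable
  \<comment> \<open>The small-ball bound is used with \<open>\<delta> = \<epsilon>\<close>. The
    factor 2 arises because \<open>sqrt q\<close> below equals
    \<open>c * \<epsilon> powr H / 2\<close>.\<close>
  define k where "k = 2 * exp ((C + 1)\<^sup>2 / 2) / c"
  have bound: "measure P E \<le> \<epsilon> + k * \<epsilon> powr (1 - H)" if \<epsilon>: "\<epsilon> \<in> {0<..<t}" for \<epsilon>
  proof -
    define s where "s = t - \<epsilon>"
    have s: "0 \<le> s" "s < t" "t \<le> T" "s \<in> {0..T}" "t - s = \<epsilon>" "0 < \<epsilon>" using \<epsilon> t by (auto simp: s_def)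
    \<comment> \<open>On \<open>E\<close>, the sum \<open>U + B t\<close> is minus the change of
      \<open>X - B\<close> over \<open>[s, t]\<close>, so the Lipschitz bound limits it to
      \<open>C * \<epsilon>\<close>.\<close>
    define U where "U \<omega> = X s \<omega> - B s \<omega> - x" for \<omega>
    have U: "U \<in> borel_measurable (A s)"
      unfolding U_def[abs_def] using X B_measurable s(4)
      by (intro borel_measurable_diff borel_measurable_const) (auto simp: adapted_def)
    have [measurable]: "U \<in> borel_measurable P" "B t \<in> borel_measurable P"
      using U B_measurable[of t] s t by (auto intro: measurable_A_imp)
    define q where "q = (c * \<epsilon> powr H)\<^sup>2 / 4"
    have q: "0 < q" using c s(6) by (simp add: q_def)
    have "AE \<omega> in P. \<omega> \<in> E \<longrightarrow> \<omega> \<in> {\<omega> \<in> space P. \<bar>U \<omega> + B t \<omega>\<bar> \<le> C * \<epsilon>}"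
      using lip
    proof eventually_elim
      case (elim \<omega>)
      then have "\<bar>(X t \<omega> - B t \<omega>) - (X s \<omega> - B s \<omega>)\<bar> \<le> C * \<bar>t - s\<bar>"
        using s(3,4) t by auto
      then show ?case using s(5,6) by (auto simp: E_def U_def abs_minus_commute)
    qed
    then have "emeasure P E \<le> emeasure P {\<omega> \<in> space P. \<bar>U \<omega> + B t \<omega>\<bar> \<le> C * \<epsilon>}"
      by (rule emeasure_mono_AE) measurable
    also have "\<dots> \<le> ennreal (\<epsilon> + \<epsilon> * exp ((C + 1)\<^sup>2 / 2) / sqrt q)"
    proof (rule wiener_integral_small_ball[OF wiener kernel_section_measurable s(1-3) U s(6) C q])
      show "ennreal (4 * q) \<le> (\<integral>\<^sup>+r\<in>{s<..t}. ennreal ((K t r)\<^sup>2) \<partial>lborel)"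
        using kernel_variance_lower[OF t \<epsilon>] by (simp add: q_def s_def)
    qed (use t in auto)
    also have "\<epsilon> + \<epsilon> * exp ((C + 1)\<^sup>2 / 2) / sqrt q = \<epsilon> + k * \<epsilon> powr (1 - H)"
    proof -
      have "sqrt q = c * \<epsilon> powr H / 2"
        using c s(6) by (simp add: q_def real_sqrt_divide real_sqrt_unique)
      then show ?thesis
        unfolding \<open>sqrt q = c * \<epsilon> powr H / 2\<close> using s(6) c by (simp add: k_def powr_diff)
    qed
    finally have "ennreal (measure P E) \<le> ennreal (\<epsilon> + k * \<epsilon> powr (1 - H))"
      by (simp only: emeasure_eq_measure)
    moreover have "0 \<le> \<epsilon> + k * \<epsilon> powr (1 - H)"
      using s(6) c by (simp add: k_def)
    ultimately show ?thesis by (simp only: ennreal_le_iff)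
  qed
  \<comment> \<open>Here \<open>H < 1\<close> enters: the exponent \<open>1 - H\<close> is positive,
    so the power tends to zero from the right.\<close>
  have "eventually (\<lambda>\<epsilon> :: real. 0 \<le> \<epsilon>) (at_right 0)"
    by (rule eventually_mono[OF eventually_at_right_less]) simp
  then have "((\<lambda>\<epsilon>. \<epsilon> powr (1 - H)) \<longlongrightarrow> 0 powr (1 - H)) (at_right 0)"
    using H by (intro tendsto_powr2[OF tendsto_ident_at tendsto_const]) simp_all
  then have "((\<lambda>\<epsilon>. \<epsilon> + k * \<epsilon> powr (1 - H)) \<longlongrightarrow> 0 + k * 0 powr (1 - H)) (at_right 0)"
    by (intro tendsto_add tendsto_mult_left tendsto_ident_at)
  then have "((\<lambda>\<epsilon>. \<epsilon> + k * \<epsilon> powr (1 - H)) \<longlongrightarrow> 0) (at_right 0)" by simp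
  moreover have "eventually (\<lambda>\<epsilon>. measure P E \<le> \<epsilon> + k * \<epsilon> powr (1 - H)) (at_right 0)"
    using bound t unfolding eventually_at_right_field by (auto intro!: exI[of _ t])
  ultimately have "measure P E \<le> 0"
    by (rule tendsto_lowerbound) simp
  then have "emeasure P E = 0"
    by (simp add: emeasure_eq_measure measure_le_0_iff)
  then have "E \<in> null_sets P" using E by (rule null_setsI)
  then show ?thesis by (rule AE_I') (auto simp: E_def)
qed

text \<open>By the equation, \<open>X - B\<close> is a constant plus the integral of a bounded
  function. The equation holds at all times off one null set, which therefore serves all pairs of
  times.\<close>

lemma strong_solution_increment_bound:
  assumes X: "strong_solution P A T B b x0 X"
    and bound: "\<And>t x. t \<in> {0..T} \<Longrightarrow> \<bar>b t x\<bar> \<le> C"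
  shows "AE \<omega> in P. \<forall>s\<in>{0..T}. \<forall>t\<in>{0..T}. \<bar>(X t \<omega> - B t \<omega>) - (X s \<omega> - B s \<omega>)\<bar> \<le> C * \<bar>t - s\<bar>"
proof -
  have "AE \<omega> in P. \<forall>t\<in>{0..T}. set_integrable lborel {0..t} (\<lambda>s. b s (X s \<omega>)) \<and>
        X t \<omega> = x0 + (LINT s:{0..t}|lborel. b s (X s \<omega>)) + B t \<omega>"
    using X by (simp add: strong_solution_def)
  then show ?thesis
  proof eventually_elim
    case (elim \<omega>)
    have le: "\<bar>(X t \<omega> - B t \<omega>) - (X s \<omega> - B s \<omega>)\<bar> \<le> C * (t - s)"
      if "s \<in> {0..T}" "t \<in> {0..T}" "s \<le> t" for s t
    proof -
      have "\<bar>(LINT r:{0..t}|lborel. b r (X r \<omega>)) - (LINT r:{0..s}|lborel. b r (X r \<omega>))\<bar> \<le> C * (t - s)"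
        using elim that bound by (intro set_lborel_integral_increment_bound) auto
      then show ?thesis using elim that by simp
    qed
    show ?case
    proof (intro ballI)
      fix s t assume "s \<in> {0..T}" "t \<in> {0..T}"
      then show "\<bar>(X t \<omega> - B t \<omega>) - (X s \<omega> - B s \<omega>)\<bar> \<le> C * \<bar>t - s\<bar>"
        using le[of s t] le[of t s] by (cases "s \<le> t") (auto simp: abs_minus_commute)
    qed
  qed
qed

section \<open>Occupation time outside \<open>M\<close> and change of drift\<close>

text \<open>A solution need not be jointly measurable, but \<open>X - B\<close> has a jointly
  measurable modification by its Lipschitz paths, and \<open>B\<close> is jointly measurable. Fubini
  then exchanges "at almost every time, almost surely" with "almost surely, at almost every
  time".\<close>

lemma strong_solution_modification:
  assumes X: "strong_solution P A T B b x0 X"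
    and bound: "\<And>t x. t \<in> {0..T} \<Longrightarrow> \<bar>b t x\<bar> \<le> C" and C: "0 \<le> C"
  obtains X' where "(\<lambda>(t, \<omega>). X' t \<omega>) \<in> borel_measurable (restrict_space borel {0..T} \<Otimes>\<^sub>M P)"
    and "AE \<omega> in P. \<forall>t\<in>{0..T}. X' t \<omega> = X t \<omega>"
    and "AE \<omega> in P. AE t in restrict_space lborel {0..T}. X' t \<omega> \<in> M"
proof -
  have adapted: "adapted A T X" using X by (simp add: strong_solution_def)
  note lip = strong_solution_increment_bound[OF X bound]
  have "X t \<in> borel_measurable P" "B t \<in> borel_measurable P" if "t \<in> {0..T}" for t
    using adapted B_measurable[OF that] that by (auto simp: adapted_def intro!: measurable_A_imp[of _ t])
  then have "(\<lambda>\<omega>. X t \<omega> - B t \<omega>) \<in> borel_measurable P" if "t \<in> {0..T}" for t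
    using that by simp
  from jointly_measurable_modification[OF this lip]
  obtain D where D: "(\<lambda>(t, \<omega>). D t \<omega>) \<in> borel_measurable (restrict_space borel {0..T} \<Otimes>\<^sub>M P)"
    and D_eq: "AE \<omega> in P. \<forall>t\<in>{0..T}. D t \<omega> = X t \<omega> - B t \<omega>"
    by blast
  define X' where "X' t \<omega> = D t \<omega> + B t \<omega>" for t \<omega>
  have X': "(\<lambda>(t, \<omega>). X' t \<omega>) \<in> borel_measurable (restrict_space borel {0..T} \<Otimes>\<^sub>M P)"
    using borel_measurable_add[OF D B_joint] by (simp add: X'_def case_prod_unfold)
  have eq: "AE \<omega> in P. \<forall>t\<in>{0..T}. X' t \<omega> = X t \<omega>"
    using D_eq by eventually_elim (simp add: X'_def)
  let ?L = "restrict_space lborel {0..T}"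
  have "sigma_finite_measure ?L"
    by (intro sigma_finite_measure_restrict_space lborel.sigma_finite_measure_axioms) simp
  then interpret L: pair_sigma_finite ?L P
    by (intro pair_sigma_finite.intro sigma_finite_measure_axioms)
  have sets_L: "sets (?L \<Otimes>\<^sub>M P) = sets (restrict_space borel {0..T} \<Otimes>\<^sub>M P)"
    by (intro sets_pair_measure_cong sets_restrict_space_cong) auto
  have [measurable]: "(\<lambda>z. X' (fst z) (snd z)) \<in> borel_measurable (?L \<Otimes>\<^sub>M P)"
    using X' by (simp add: case_prod_unfold cong: measurable_cong_sets[OF sets_L refl])
  \<comment> \<open>Time zero is discarded: there the solution is almost surely at
    \<open>x0\<close>, which may lie outside \<open>M\<close>.\<close>
  have "AE t in lborel. t \<in> {0..T} \<longrightarrow> (AE \<omega> in P. X' t \<omega> \<in> M)"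
    using AE_lborel_singleton[of 0]
  proof eventually_elim
    case (elim t)
    show ?case
    proof
      assume t: "t \<in> {0..T}"
      have "AE \<omega> in P. \<forall>x\<in>UNIV - M. X t \<omega> \<noteq> x"
        using t elim AE_neq_point[OF _ adapted C lip] by (subst AE_ball_countable[OF countable_compl]) auto
      then show "AE \<omega> in P. X' t \<omega> \<in> M"
        using eq by eventually_elim (use t in auto)
    qed
  qed
  then have "AE t in ?L. AE \<omega> in P. X' t \<omega> \<in> M"
    by (subst AE_restrict_space_iff) auto
  then have "AE \<omega> in P. AE t in ?L. X' t \<omega> \<in> M"
    by (subst (asm) L.AE_commute) measurable
  with X' eq show ?thesis by (rule that)
qed

text \<open>Almost every path is in \<open>M\<close> at almost every time, so both drifts have the
  same integrals along it. Integrability of the new drift also requires measurability along the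
  path, which is obtained from the jointly measurable modification.\<close>

lemma strong_solution_transfer:
  assumes X: "strong_solution P A T B b x0 X"
    and bound: "\<And>t x. t \<in> {0..T} \<Longrightarrow> \<bar>b t x\<bar> \<le> C" and C: "0 \<le> C"
    and b': "(\<lambda>(t, x). b' t x) \<in> borel_measurable (restrict_space borel {0..T} \<Otimes>\<^sub>M borel)"
    and agree: "\<And>t x. t \<in> {0..T} \<Longrightarrow> x \<in> M \<Longrightarrow> b' t x = b t x"
  shows "strong_solution P A T B b' x0 X"
proof -
  obtain X' where X': "(\<lambda>(t, \<omega>). X' t \<omega>) \<in> borel_measurable (restrict_space borel {0..T} \<Otimes>\<^sub>M P)"
    and eq: "AE \<omega> in P. \<forall>t\<in>{0..T}. X' t \<omega> = X t \<omega>"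
    and in_M: "AE \<omega> in P. AE t in restrict_space lborel {0..T}. X' t \<omega> \<in> M"
    using strong_solution_modification[OF X bound C] by blast
  have sol: "AE \<omega> in P. \<forall>t\<in>{0..T}. set_integrable lborel {0..t} (\<lambda>s. b s (X s \<omega>)) \<and>
        X t \<omega> = x0 + (LINT s:{0..t}|lborel. b s (X s \<omega>)) + B t \<omega>"
    using X by (simp add: strong_solution_def)
  have "AE \<omega> in P. \<forall>t\<in>{0..T}. set_integrable lborel {0..t} (\<lambda>s. b' s (X s \<omega>)) \<and>
        X t \<omega> = x0 + (LINT s:{0..t}|lborel. b' s (X s \<omega>)) + B t \<omega>"
    using eq in_M sol AE_space[of P]
  proof eventually_elim
    case (elim \<omega>)
    have path: "(\<lambda>s. X' s \<omega>) \<in> borel_measurable (restrict_space borel {0..T})"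
      using measurable_compose[OF measurable_Pair2'[OF elim(4)] X'] by simp
    have "(\<lambda>s. (s, X' s \<omega>)) \<in> measurable (restrict_space borel {0..T}) (restrict_space borel {0..T} \<Otimes>\<^sub>M borel)"
      using path by (intro measurable_Pair) auto
    from measurable_compose[OF this b']
    have "(\<lambda>s. b' s (X' s \<omega>)) \<in> borel_measurable (restrict_space borel {0..T})"
      by simp
    then have b'_meas: "(\<lambda>s. indicator {0..T} s *\<^sub>R b' s (X' s \<omega>)) \<in> borel_measurable borel"
      by (subst (asm) borel_measurable_restrict_space_iff) auto
    have in_M': "AE s in lborel. s \<in> {0..T} \<longrightarrow> X s \<omega> \<in> M"
      using elim(2) by (subst (asm) AE_restrict_space_iff) (use elim(1) in \<open>auto elim: eventually_mono\<close>)
    show ?case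
    proof
      fix t assume t: "t \<in> {0..T}"
      let ?f = "\<lambda>s. indicator {0..t} s *\<^sub>R b s (X s \<omega>)" and ?g = "\<lambda>s. indicator {0..t} s *\<^sub>R b' s (X s \<omega>)"
      have int: "integrable lborel ?f"
        using elim(3) t by (auto simp: set_integrable_def)
      \<comment> \<open>Off the null set the path of \<open>X\<close> equals that of
        \<open>X'\<close> on \<open>[0, T]\<close>, so the measurability known for \<open>X'\<close>
        carries over.\<close>
      have g_eq: "?g = (\<lambda>s. indicator {0..t} s *\<^sub>R (indicator {0..T} s *\<^sub>R b' s (X' s \<omega>)))"
        using elim(1) t by (auto split: split_indicator)
      have g_meas: "?g \<in> borel_measurable lborel"
        unfolding g_eq using b'_meas by simp
      have ae: "AE s in lborel. ?f s = ?g s"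
        using in_M' by eventually_elim (use t agree in \<open>auto split: split_indicator\<close>)
      have "integrable lborel ?g"
        using int g_meas ae by (rule integrable_cong_AE_imp)
      moreover have "integral\<^sup>L lborel ?f = integral\<^sup>L lborel ?g"
        using int g_meas ae by (intro integral_cong_AE) auto
      ultimately show "set_integrable lborel {0..t} (\<lambda>s. b' s (X s \<omega>)) \<and>
        X t \<omega> = x0 + (LINT s:{0..t}|lborel. b' s (X s \<omega>)) + B t \<omega>"
        using elim(3) t by (auto simp: set_integrable_def set_lebesgue_integral_def)
    qed
  qed
  then show ?thesis
    using X by (simp add: strong_solution_def)
qed

text \<open>Both drifts are bounded and agree on \<open>M\<close>, so the transfer applies in both
  directions: the solution sets coincide, and existence and uniqueness carry over together.\<close>

lemma unique_strong_solution_restrict_drift: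
  assumes b: "(\<lambda>(t, x). b t x) \<in> borel_measurable (restrict_space borel {0..T} \<Otimes>\<^sub>M borel)"
    and bound: "\<And>t x. t \<in> {0..T} \<Longrightarrow> \<bar>b t x\<bar> \<le> C"
    and unique: "unique_strong_solution P A T B b x0"
  shows "unique_strong_solution P A T B (\<lambda>t x. b t x * indicator M x) x0"
proof -
  let ?b' = "\<lambda>t x. b t x * indicator M x"
  \<comment> \<open>The absolute value supplies the nonnegative bound needed for the transfer
    without a point of \<open>{0..T}\<close> at hand; it also covers the zero values of the
    restricted drift.\<close>
  have bound_abs: "\<bar>b t x\<bar> \<le> \<bar>C\<bar>" "\<bar>?b' t x\<bar> \<le> \<bar>C\<bar>" if "t \<in> {0..T}" for t x
    using bound[OF that, of x] by (auto split: split_indicator)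
  have b'_meas: "(\<lambda>(t, x). ?b' t x) \<in> borel_measurable (restrict_space borel {0..T} \<Otimes>\<^sub>M borel)"
    using b unfolding case_prod_unfold by measurable
  have "strong_solution P A T B ?b' x0 X \<longleftrightarrow> strong_solution P A T B b x0 X" for X
  proof
    show "strong_solution P A T B b x0 X" if "strong_solution P A T B ?b' x0 X"
      using that bound_abs(2) abs_ge_zero b by (rule strong_solution_transfer) simp_all
    show "strong_solution P A T B ?b' x0 X" if "strong_solution P A T B b x0 X"
      using that bound_abs(1) abs_ge_zero b'_meas by (rule strong_solution_transfer) simp_all
  qed
  then show ?thesis
    using unique by (simp add: unique_strong_solution_def)
qed

text \<open>With constant drift the right-hand side of the equation does not involve the solution
  and is an explicit adapted process.\<close>

lemma unique_strong_solution_const_drift: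
  "unique_strong_solution P A T B (\<lambda>_ _. a) x0"
proof -
  have drift: "set_integrable lborel {0..t} (\<lambda>_. a)" "(LINT s:{0..t}|lborel. a) = t * a" if "t \<in> {0..T}" for t
    using that by (simp_all add: set_integrable_def set_lebesgue_integral_def)
  have "strong_solution P A T B (\<lambda>_ _. a) x0 (\<lambda>t \<omega>. x0 + t * a + B t \<omega>)"
    unfolding strong_solution_def adapted_def
    using drift B_measurable by (auto intro!: borel_measurable_add)
  moreover have "AE \<omega> in P. \<forall>t\<in>{0..T}. X t \<omega> = Y t \<omega>"
    if "strong_solution P A T B (\<lambda>_ _. a) x0 X" "strong_solution P A T B (\<lambda>_ _. a) x0 Y" for X Y
  proof -
    have "AE \<omega> in P. \<forall>t\<in>{0..T}. X t \<omega> = x0 + (LINT s:{0..t}|lborel. a) + B t \<omega>"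
      "AE \<omega> in P. \<forall>t\<in>{0..T}. Y t \<omega> = x0 + (LINT s:{0..t}|lborel. a) + B t \<omega>"
      using that by (auto simp: strong_solution_def)
    then show ?thesis by eventually_elim simp
  qed
  ultimately show ?thesis unfolding unique_strong_solution_def by blast
qed

end

theorem theorem1p4:
  fixes P :: "'w measure"
    and A :: "real \<Rightarrow> 'w measure"
    and W B :: "real \<Rightarrow> 'w \<Rightarrow> real"
    and K :: "real \<Rightarrow> real \<Rightarrow> real"
    and T H c x0 :: real
    and M :: "real set"
  assumes "0 < T"
    and "prob_space P" and "complete_measure P"
    and "A = augmented_filtration P W"
    and "brownian_motion P A T W"
    and "L2_kernel T K"
    and "volterra_process P T W K B"
    and "0 < H" and "H < 1" and "0 < c"
    and "\<And>t \<epsilon>. t \<in> {0<..T} \<Longrightarrow> \<epsilon> \<in> {0<..<t} \<Longrightarrow>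
           c * \<epsilon> powr H \<le> sqrt (LINT s:{t - \<epsilon>..t}|lborel. (K t s)\<^sup>2)"
    and "countable (UNIV - M)"
  shows "unique_strong_solution P A T B (\<lambda>t x. indicator M x) x0 \<and>
    (\<forall>b :: real \<Rightarrow> real \<Rightarrow> real.
       (\<lambda>(t, x). b t x) \<in> borel_measurable (restrict_space borel {0..T} \<Otimes>\<^sub>M borel) \<longrightarrow>
       (\<exists>C. \<forall>t\<in>{0..T}. \<forall>x. \<bar>b t x\<bar> \<le> C) \<longrightarrow>
       unique_strong_solution P A T B b x0 \<longrightarrow>
       unique_strong_solution P A T B (\<lambda>t x. b t x * indicator M x) x0)"
proof -
  interpret volterra_sde P T W K B H c M
    using assms by (intro volterra_sde.intro brownian_filtration.intro
      brownian_filtration_axioms.intro volterra_sde_axioms.intro) auto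
  have A: "A = augmented_filtration P W" by fact
  \<comment> \<open>The first claim is the restriction to \<open>M\<close> of the constant drift
    1.\<close>
  have "unique_strong_solution P A T B (\<lambda>t x. 1 * indicator M x) x0"
    unfolding A by (rule unique_strong_solution_restrict_drift[of _ 1])
      (auto intro: unique_strong_solution_const_drift)
  then have part1: "unique_strong_solution P A T B (\<lambda>t x. indicator M x) x0"
    by simp
  show ?thesis
  proof (intro conjI allI impI)
    fix b :: "real \<Rightarrow> real \<Rightarrow> real"
    assume b: "(\<lambda>(t, x). b t x) \<in> borel_measurable (restrict_space borel {0..T} \<Otimes>\<^sub>M borel)"
      and "\<exists>C. \<forall>t\<in>{0..T}. \<forall>x. \<bar>b t x\<bar> \<le> C"
      and unique: "unique_strong_solution P A T B b x0"
    then obtain C where C: "\<And>t x. t \<in> {0..T} \<Longrightarrow> \<bar>b t x\<bar> \<le> C"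
      by blast
    show "unique_strong_solution P A T B (\<lambda>t x. b t x * indicator M x) x0"
      unfolding A by (rule unique_strong_solution_restrict_drift[OF b C unique[unfolded A]])
  qed (rule part1)
qed

end
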